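(* Let $L\colon A\to\mathbb{R}$ be a linear functional with $L(a^2)\ge 0$ for all $a\in A$ and $L(1)=1$. Then there exists a unique representing Radon measure $\nu_L$ for $L$ with compact support if and only if $$\sup_{n\in\mathbb{N}}\sqrt[2n]{L(a^{2n})}<\infty\quad\text{for all }a\in A.$$ Moreover, in this case, $$\operatorname{supp}(\nu_L)=\Big\{\alpha\in X(A): |\alpha(a)|\leq \sup_{n\in\mathbb{N}}\sqrt[2n]{L(a^{2n})}\ \text{ for all }a\in A\Big\}.$$
   Context: $A$ is a unital commutative $\mathbb{R}$-algebra (not necessarily finitely generated) whose character space $X(A)$, i.e. the set of all (unital) $\mathbb{R}$-algebra homomorphisms $A\to\mathbb{R}$, is non-empty. For $a\in A$ let $\hat a\colon X(A)\to\mathbb{R}$, $\hat a(\alpha)=\alpha(a)$. $X(A)$ carries the weakest topology $\tau_{X(A)}$ making all $\hat a$ ($a\in A$) continuous; it is Hausdorff. A Radon measure on $X(A)$ is a non-negative measure on the Borel $\sigma$-algebra of $X(A)$ that is locally finite and inner regular with respect to compact subsets. The support $\operatorname{supp}(\nu)$ is the smallest closed $C\subseteq X(A)$ with $\nu(X(A)\setminus C)=0$. A representing Radon measure for $L$ is a Radon measure $\nu$ on $X(A)$ with $L(a)=\int_{X(A)}\hat a(\alpha)\,\mathrm{d}\nu(\alpha)$ for all $a\in A$. $\mathbb{N}=\{1,2,\dots\}$. *)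

theory Defs
  imports "HOL-Analysis.Analysis"
begin

text \<open>
  The algebra \<open>A\<close> is the whole of a type \<open>'a :: {real_algebra_1, comm_ring_1}\<close>. These classes
  include \<open>0 \<noteq> 1\<close>, which is implied by the existence of a character.
\<close>

definition character_space :: "('a::{real_algebra_1, comm_ring_1} \<Rightarrow> real) set" where
  "character_space =
     {\<alpha>. linear \<alpha> \<and> \<alpha> 1 = 1 \<and> (\<forall>a b. \<alpha> (a * b) = \<alpha> a * \<alpha> b)}"

text \<open>
  The weakest topology on the character space making all evaluations \<open>\<alpha> \<mapsto> \<alpha> a\<close> continuous: the
  preimages of open sets are a subbasis. Taking \<open>U = UNIV\<close> shows that the carrier is the whole
  character space.
\<close>

definition character_topology :: "('a::{real_algebra_1, comm_ring_1} \<Rightarrow> real) topology" where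
  "character_topology =
     topology_generated_by {{\<alpha> \<in> character_space. \<alpha> a \<in> U} | a U. open U}"

lemma topspace_character_topology [simp]: "topspace character_topology = character_space"
  unfolding character_topology_def topology_generated_by_topspace by blast

definition radon_measure :: "'b topology \<Rightarrow> 'b measure \<Rightarrow> bool" where
  "radon_measure T \<nu> \<longleftrightarrow>
     space \<nu> = topspace T \<and>
     sets \<nu> = sigma_sets (topspace T) {U. openin T U} \<and>
     (\<forall>x\<in>topspace T. \<exists>U. openin T U \<and> x \<in> U \<and> emeasure \<nu> U < \<infinity>) \<and>
     (\<forall>B\<in>sets \<nu>. emeasure \<nu> B = (SUP K\<in>{K. compactin T K \<and> K \<subseteq> B}. emeasure \<nu> K))"

definition measure_support :: "'b topology \<Rightarrow> 'b measure \<Rightarrow> 'b set" where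
  "measure_support T \<nu> = (LEAST C. closedin T C \<and> emeasure \<nu> (topspace T - C) = 0)"

text \<open>The set order is inclusion. For a Radon measure the least such closed set exists:\<close>

lemma measure_support_radon:
  assumes R: "radon_measure T \<nu>"
  shows "closedin T (measure_support T \<nu>)"
    and "emeasure \<nu> (topspace T - measure_support T \<nu>) = 0"
    and "\<And>C. closedin T C \<Longrightarrow> emeasure \<nu> (topspace T - C) = 0 \<Longrightarrow> measure_support T \<nu> \<subseteq> C"
proof -
  let ?P = "\<lambda>C. closedin T C \<and> emeasure \<nu> (topspace T - C) = 0"
  define \<U> where "\<U> = {U. openin T U \<and> emeasure \<nu> U = 0}"
  have meas: "U \<in> sets \<nu>" if "openin T U" for U
    using R that by (auto simp: radon_measure_def)
  have op: "openin T (\<Union>\<U>)"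
    by (auto simp: \<U>_def)
  have K0: "emeasure \<nu> K = 0" if K: "compactin T K" "K \<subseteq> \<Union>\<U>" for K
  proof -
    from K obtain \<F> where F: "finite \<F>" "\<F> \<subseteq> \<U>" "K \<subseteq> \<Union>\<F>"
      unfolding compactin_def by (metis (no_types, lifting) \<U>_def mem_Collect_eq)
    have "\<Union>\<F> \<in> null_sets \<nu>"
      using F meas by (intro null_sets_UN'[where N = id, simplified] countable_finite)
        (auto simp: \<U>_def null_sets_def)
    then show ?thesis
      using emeasure_mono[OF F(3)] by (metis le_zero_eq null_setsD1 null_setsD2)
  qed
  have "emeasure \<nu> (\<Union>\<U>) = (SUP K\<in>{K. compactin T K \<and> K \<subseteq> \<Union>\<U>}. emeasure \<nu> K)"
    using R meas[OF op] by (simp add: radon_measure_def)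
  also have "\<dots> = 0"
    using K0 by (intro antisym SUP_least) auto
  finally have null: "emeasure \<nu> (\<Union>\<U>) = 0" .
  have sub: "\<Union>\<U> \<subseteq> topspace T"
    using op by (rule openin_subset)
  define S where "S = topspace T - \<Union>\<U>"
  have PS: "?P S"
    using op null sub by (simp add: S_def Diff_Diff_Int Int_absorb1 closedin_diff)
  have min: "S \<subseteq> C" if "?P C" for C
  proof -
    have "topspace T - C \<in> \<U>"
      using that by (auto simp: \<U>_def)
    then show ?thesis
      by (auto simp: S_def)
  qed
  have "measure_support T \<nu> = S"
    unfolding measure_support_def using PS min by (intro Least_equality) auto
  then show "closedin T (measure_support T \<nu>)"
    and "emeasure \<nu> (topspace T - measure_support T \<nu>) = 0"
    and "\<And>C. closedin T C \<Longrightarrow> emeasure \<nu> (topspace T - C) = 0 \<Longrightarrow> measure_support T \<nu> \<subseteq> C"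
    using PS min by auto
qed

text \<open>Integrability is explicit because the Bochner integral of a non-integrable function is 0.\<close>

definition representing_radon_measure ::
    "('a::{real_algebra_1, comm_ring_1} \<Rightarrow> real) \<Rightarrow> ('a \<Rightarrow> real) measure \<Rightarrow> bool" where
  "representing_radon_measure L \<nu> \<longleftrightarrow>
     radon_measure character_topology \<nu> \<and>
     (\<forall>a. integrable \<nu> (\<lambda>\<alpha>. \<alpha> a) \<and> L a = (\<integral>\<alpha>. \<alpha> a \<partial>\<nu>))"

definition compactly_supported :: "'b topology \<Rightarrow> 'b measure \<Rightarrow> bool" where
  "compactly_supported T \<nu> \<longleftrightarrow> compactin T (measure_support T \<nu>)"

text \<open>The supremum is taken in the extended reals, so it may be \<open>\<infinity>\<close>.\<close>

definition moment_growth :: "('a::{real_algebra_1, comm_ring_1} \<Rightarrow> real) \<Rightarrow> 'a \<Rightarrow> ereal" where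
  "moment_growth L a = (SUP n\<in>{1..}. ereal (root (2 * n) (L (a ^ (2 * n)))))"

end

theory Submission
  imports Defs
begin

text \<open>
  Write \<open>p a\<close> for the supremum of the \<open>2n\<close>-th roots of the moments, assumed finite. The states, that is
  the square-positive normalized functionals \<open>\<phi>\<close> with \<open>\<bar>\<phi> c\<bar> \<le> p c\<close>, form a compact subset of \<open>\<real>\<^sup>A\<close>
  containing \<open>L\<close>. Since \<open>p (a ^ n) \<le> p a ^ n\<close>, iterating the Cauchy-Schwarz inequality shows that
  \<open>c \<mapsto> \<phi> (s\<^sup>2 * c)\<close> and \<open>c \<mapsto> \<phi> ((r\<^sup>2 - s\<^sup>2) * c)\<close> are again multiples of states whenever \<open>r > p s\<close>; hence
  extreme states are multiplicative. As every evaluation attains its minimum over the states at an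
  extreme point, \<open>L a\<close> is at least the minimum of \<open>\<alpha> a\<close> over the compact set of characters \<open>\<alpha>\<close> bounded
  by \<open>p\<close>. By the Stone-Weierstrass theorem \<open>L\<close> extends to a positive functional on the continuous
  functions on this set, and the Riesz representation theorem provides the measure.

  The moments of a compactly supported representing measure grow like the maximum of \<open>\<bar>\<alpha> a\<bar>\<close> over its
  support, and a character outside the support is separated from it by some \<open>a\<close>; this identifies the
  support. Uniqueness follows from Stone-Weierstrass and Urysohn, because a Radon measure is
  determined by its values on compact sets.
\<close>

section \<open>The topology of the character space\<close>

lemma open_coordinate_vimage:
  fixes W :: "'b::topological_space set"
  assumes "open W"
  shows "open ((\<lambda>h::'a \<Rightarrow> 'b. h x) -` W)"
  using assms by (intro open_vimage) auto

text \<open>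
  The weaker separation classes are instantiated first because the metric on function spaces with
  countable domain already provides more restrictive instances of them.
\<close>

instance "fun" :: (type, t0_space) t0_space
proof
  fix f g :: "'a \<Rightarrow> 'b"
  assume "f \<noteq> g"
  then obtain x where "f x \<noteq> g x"
    by auto
  then obtain U where "open U" "\<not> (f x \<in> U \<longleftrightarrow> g x \<in> U)"
    using separation_t0[of "f x" "g x"] by auto
  then show "\<exists>U. open U \<and> \<not> (f \<in> U \<longleftrightarrow> g \<in> U)"
    by (intro exI[of _ "(\<lambda>h. h x) -` U"]) (auto simp: open_coordinate_vimage)
qed

instance "fun" :: (type, t1_space) t1_space
proof
  fix f g :: "'a \<Rightarrow> 'b"
  assume "f \<noteq> g"
  then obtain x where "f x \<noteq> g x"
    by auto
  then obtain U where "open U" "f x \<in> U" "g x \<notin> U"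
    using separation_t1[of "f x" "g x"] by auto
  then show "\<exists>U. open U \<and> f \<in> U \<and> g \<notin> U"
    by (intro exI[of _ "(\<lambda>h. h x) -` U"]) (auto simp: open_coordinate_vimage)
qed

instance "fun" :: (type, t2_space) t2_space
proof
  fix f g :: "'a \<Rightarrow> 'b"
  assume "f \<noteq> g"
  then obtain x where "f x \<noteq> g x"
    by auto
  then obtain U V where "open U" "open V" "f x \<in> U" "g x \<in> V" "U \<inter> V = {}"
    using hausdorff[of "f x" "g x"] by auto
  then show "\<exists>U V. open U \<and> open V \<and> f \<in> U \<and> g \<in> V \<and> U \<inter> V = {}"
    by (intro exI[of _ "(\<lambda>h. h x) -` U"] exI[of _ "(\<lambda>h. h x) -` V"])
      (auto simp: open_coordinate_vimage)
qed

text \<open>Gives access to the \<open>open\<close>, \<open>closed\<close> and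
  \<open>compact\<close> of the function type, that is, to pointwise convergence. The converse
  inclusion holds because a map into a product is continuous once its coordinates are.\<close>

lemma character_topology_eq_subtopology:
  "character_topology = top_of_set (character_space :: ('a::{real_algebra_1, comm_ring_1} \<Rightarrow> real) set)"
proof (rule topology_eq[THEN iffD2], intro allI iffI)
  let ?X = "character_space :: ('a \<Rightarrow> real) set"
  fix S :: "('a \<Rightarrow> real) set"
  assume "openin character_topology S"
  then have "generate_topology_on {{\<alpha> \<in> character_space. \<alpha> a \<in> U} | a U. open U} S"
    by (simp add: character_topology_def openin_topology_generated_by_iff)
  then show "openin (top_of_set ?X) S"
  proof induction
    case (Basis s)
    then obtain a U where s: "s = {\<alpha> \<in> character_space. \<alpha> a \<in> U}" "open U" by blast
    have "open ((\<lambda>\<alpha>. \<alpha> a) -` U)"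
      using s by (simp add: open_coordinate_vimage)
    moreover have "s = ?X \<inter> (\<lambda>\<alpha>. \<alpha> a) -` U" using s by auto
    ultimately show ?case by (auto simp: openin_open)
  qed auto
next
  let ?X = "character_space :: ('a \<Rightarrow> real) set"
  have "continuous_map character_topology euclidean (\<lambda>\<alpha>. \<alpha> :: 'a \<Rightarrow> real)"
    unfolding euclidean_product_topology[symmetric]
  proof (subst continuous_map_componentwise_UNIV, intro allI)
    fix a :: 'a
    show "continuous_map character_topology euclidean (\<lambda>\<alpha>. \<alpha> a)"
      unfolding continuous_map_def topspace_character_topology
      by (auto simp: character_topology_def intro!: topology_generated_by_Basis)
  qed
  then have "openin character_topology {\<alpha> \<in> topspace character_topology. \<alpha> \<in> T}"
    if "open T" for T :: "('a \<Rightarrow> real) set"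
    using openin_continuous_map_preimage[of character_topology euclidean "\<lambda>\<alpha>. \<alpha>" T] that by simp
  then show "openin character_topology S" if "openin (top_of_set ?X) S" for S
    using that by (auto simp: openin_open Int_def)
qed

section \<open>Extreme points of compact sets of functions\<close>

definition convex_split :: "real \<Rightarrow> ('a \<Rightarrow> real) \<Rightarrow> ('a \<Rightarrow> real) \<Rightarrow> ('a \<Rightarrow> real) \<Rightarrow> bool" where
  "convex_split t \<phi> \<psi> \<xi> \<longleftrightarrow> 0 < t \<and> t < 1 \<and> (\<forall>x. \<phi> x = t * \<psi> x + (1 - t) * \<xi> x)"

definition face_of_funs :: "('a \<Rightarrow> real) set \<Rightarrow> ('a \<Rightarrow> real) set \<Rightarrow> bool" where
  "face_of_funs F S \<longleftrightarrow> F \<subseteq> S \<and>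
     (\<forall>\<phi>\<in>F. \<forall>\<psi>\<in>S. \<forall>\<xi>\<in>S. \<forall>t. convex_split t \<phi> \<psi> \<xi> \<longrightarrow> \<psi> \<in> F \<and> \<xi> \<in> F)"

lemma face_of_funs_subset: "face_of_funs F S \<Longrightarrow> F \<subseteq> S"
  by (simp add: face_of_funs_def)

lemma continuous_on_coordinate: "continuous_on S (\<lambda>\<phi>. \<phi> a)"
  by (rule continuous_on_subset[OF continuous_on_product_coordinates]) auto

text \<open>A convex combination with positive weights attains the minimum of a coordinate only if
  both terms do. This shrinks a compact face.\<close>

lemma minimizers_of_coordinate:
  fixes F :: "('a \<Rightarrow> real) set" and a :: 'a
  assumes F: "face_of_funs F S" "compact F" "F \<noteq> {}"
  defines "G \<equiv> {\<phi>\<in>F. \<forall>\<psi>\<in>F. \<phi> a \<le> \<psi> a}"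
  shows "face_of_funs G S" "compact G" "G \<noteq> {}"
proof -
  obtain \<phi>0 where \<phi>0: "\<phi>0 \<in> F" "\<forall>\<psi>\<in>F. \<phi>0 a \<le> \<psi> a"
    using continuous_attains_inf[OF F(2,3) continuous_on_coordinate] by blast
  then show "G \<noteq> {}"
    by (auto simp: G_def)
  have G: "G = F \<inter> {\<phi>. \<phi> a \<le> \<phi>0 a}"
    using \<phi>0 by (force simp: G_def)
  have "closed {\<phi>. \<phi> a \<le> \<phi>0 a}"
    by (intro closed_Collect_le continuous_on_coordinate continuous_on_const)
  then show "compact G"
    unfolding G using F(2) by (simp add: compact_Int_closed)
  show "face_of_funs G S"
    unfolding face_of_funs_def
  proof (intro conjI ballI allI impI)
    show "G \<subseteq> S"
      using face_of_funs_subset[OF F(1)] by (auto simp: G_def)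
    fix \<phi> \<psi> \<xi> t
    assume *: "\<phi> \<in> G" "\<psi> \<in> S" "\<xi> \<in> S" "convex_split t \<phi> \<psi> \<xi>"
    then have in_F: "\<psi> \<in> F" "\<xi> \<in> F"
      using F(1) unfolding G_def face_of_funs_def by blast+
    have t: "0 < t" "t < 1" "\<phi> a = t * \<psi> a + (1 - t) * \<xi> a"
      using * by (auto simp: convex_split_def)
    have le: "\<phi>0 a \<le> \<psi> a" "\<phi>0 a \<le> \<xi> a" "\<phi> a \<le> \<phi>0 a"
      using \<phi>0 in_F * by (auto simp: G_def)
    have "t * (\<psi> a - \<phi>0 a) + (1 - t) * (\<xi> a - \<phi>0 a) \<le> 0"
      using le t by (simp add: algebra_simps)
    moreover have "0 \<le> t * (\<psi> a - \<phi>0 a)" "0 \<le> (1 - t) * (\<xi> a - \<phi>0 a)"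
      using le t by auto
    ultimately have "t * (\<psi> a - \<phi>0 a) \<le> 0" "(1 - t) * (\<xi> a - \<phi>0 a) \<le> 0"
      by linarith+
    then have "\<psi> a \<le> \<phi>0 a" "\<xi> a \<le> \<phi>0 a"
      using t by (auto simp: mult_le_0_iff)
    then show "\<psi> \<in> G" "\<xi> \<in> G"
      using in_F by (auto simp: G)
  qed
qed

text \<open>The Krein-Milman argument with coordinates as separating functionals: a minimal compact
  face inside the face of minimizers of \<open>\<phi> a\<close> is a single point, and a one-point
  face is an extreme point.\<close>

lemma ex_extreme_minimizer:
  fixes S :: "('a \<Rightarrow> real) set" and a :: 'a
  assumes S: "compact S" "S \<noteq> {}"
  obtains \<phi> where "\<phi> \<in> S" "\<And>\<psi>. \<psi> \<in> S \<Longrightarrow> \<phi> a \<le> \<psi> a"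
    "\<And>t \<psi> \<xi>. \<psi> \<in> S \<Longrightarrow> \<xi> \<in> S \<Longrightarrow> convex_split t \<phi> \<psi> \<xi> \<Longrightarrow> \<psi> = \<phi>"
proof -
  have "face_of_funs S S"
    by (auto simp: face_of_funs_def)
  note F0 = minimizers_of_coordinate[OF this S, of a]
  define F0 where "F0 = {\<phi>\<in>S. \<forall>\<psi>\<in>S. \<phi> a \<le> \<psi> a}"
  define A where "A = {F. face_of_funs F S \<and> compact F \<and> F \<noteq> {} \<and> F \<subseteq> F0}"
  have F0A: "F0 \<in> A"
    using F0 by (auto simp: A_def F0_def)
  \<comment> \<open>The order is reverse inclusion, so Zorn's lemma yields a minimal face.\<close>
  have "\<exists>M\<in>A. \<forall>F\<in>A. M \<supseteq> F \<longrightarrow> F = M"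
  proof (rule predicate_Zorn)
    show "partial_order_on A (relation_of (\<supseteq>) A)"
      by (rule partial_order_on_relation_ofI) auto
    fix C
    assume C: "C \<in> Chains (relation_of (\<supseteq>) A)"
    then have CA: "C \<subseteq> A" and total: "\<And>F G. F \<in> C \<Longrightarrow> G \<in> C \<Longrightarrow> F \<subseteq> G \<or> G \<subseteq> F"
      by (auto simp: Chains_def relation_of_def)
    show "\<exists>U\<in>A. \<forall>F\<in>C. U \<subseteq> F"
    proof (cases "C = {}")
      case True
      then show ?thesis using F0A by auto
    next
      case False
      have closed_C: "closed F" if "F \<in> C" for F
        using that CA by (auto simp: A_def compact_imp_closed)
      \<comment> \<open>A non-empty finite chain contains its own intersection, which is a member of
        \<open>A\<close> and so non-empty; compactness of \<open>S\<close> passes this on to the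
        whole chain.\<close>
      have fin: "S \<inter> \<Inter>D \<noteq> {}" if "finite D" "D \<subseteq> C" for D
      proof (cases "D = {}")
        case True
        then show ?thesis using S by simp
      next
        case ne: False
        have "\<Inter>D \<in> D"
          using \<open>finite D\<close> ne \<open>D \<subseteq> C\<close>
        proof (induction rule: finite_ne_induct)
          case (insert F D)
          then have "F \<subseteq> \<Inter>D \<or> \<Inter>D \<subseteq> F"
            using total[of F "\<Inter>D"] by blast
          then have "F \<inter> \<Inter>D = F \<or> F \<inter> \<Inter>D = \<Inter>D"
            by blast
          then show ?case using insert by auto
        qed simp
        then have "\<Inter>D \<noteq> {}" "face_of_funs (\<Inter>D) S"
          using that CA by (auto simp: A_def)
        then show ?thesis
          using face_of_funs_subset by blast
      qed
      have "S \<inter> \<Inter>C \<noteq> {}"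
        by (rule compact_imp_fip[OF S(1) closed_C fin])
      obtain F where F: "F \<in> C" using False by blast
      have "\<Inter>C = F \<inter> \<Inter>C" using F by auto
      then have "compact (\<Inter>C)"
        using F CA closed_C
        by (metis (mono_tags, lifting) A_def closed_Inter compact_Int_closed mem_Collect_eq subsetD)
      moreover have "face_of_funs (\<Inter>C) S"
        unfolding face_of_funs_def
      proof (intro conjI ballI allI impI)
        show "\<Inter>C \<subseteq> S" using F CA face_of_funs_subset[of F S] by (auto simp: A_def)
        fix \<phi> \<psi> \<xi> t
        assume *: "\<phi> \<in> \<Inter>C" "\<psi> \<in> S" "\<xi> \<in> S" "convex_split t \<phi> \<psi> \<xi>"
        have "\<psi> \<in> G \<and> \<xi> \<in> G" if "G \<in> C" for G
        proof -
          have "face_of_funs G S" using that CA by (auto simp: A_def)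
          then show ?thesis using * that unfolding face_of_funs_def by blast
        qed
        then show "\<psi> \<in> \<Inter>C" "\<xi> \<in> \<Inter>C" by auto
      qed
      moreover have "\<Inter>C \<subseteq> F0" using F CA by (auto simp: A_def)
      ultimately have "\<Inter>C \<in> A"
        using \<open>S \<inter> \<Inter>C \<noteq> {}\<close> unfolding A_def by blast
      then show ?thesis by blast
    qed
  qed
  then obtain M where MA: "M \<in> A" and min: "\<And>F. F \<in> A \<Longrightarrow> F \<subseteq> M \<Longrightarrow> F = M"
    by blast
  then have M: "face_of_funs M S" "compact M" "M \<noteq> {}" "M \<subseteq> F0"
    by (auto simp: A_def)
  have single: "\<phi> = \<psi>" if "\<phi> \<in> M" "\<psi> \<in> M" for \<phi> \<psi>
  proof
    fix b
    \<comment> \<open>By minimality the minimizers of each coordinate \<open>b\<close> exhaust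
      \<open>M\<close>, so every coordinate is constant on \<open>M\<close>.\<close>
    let ?G = "{\<phi>\<in>M. \<forall>\<psi>\<in>M. \<phi> b \<le> \<psi> b}"
    have "?G \<in> A"
      using minimizers_of_coordinate[OF M(1-3), of b] M(4) by (auto simp: A_def)
    then have "?G = M" by (intro min) auto
    then have "\<phi> b \<le> \<psi> b" "\<psi> b \<le> \<phi> b" using that by blast+
    then show "\<phi> b = \<psi> b" by simp
  qed
  obtain \<phi> where \<phi>: "\<phi> \<in> M" using M by blast
  show ?thesis
  proof (rule that)
    show "\<phi> \<in> S" "\<And>\<psi>. \<psi> \<in> S \<Longrightarrow> \<phi> a \<le> \<psi> a"
      using \<phi> M(4) by (auto simp: F0_def)
    fix t \<psi> \<xi>
    assume "\<psi> \<in> S" "\<xi> \<in> S" "convex_split t \<phi> \<psi> \<xi>"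
    then have "\<psi> \<in> M"
      using M(1) \<phi> unfolding face_of_funs_def by blast
    then show "\<psi> = \<phi>" using single \<phi> by blast
  qed
qed

section \<open>Square-positive functionals of bounded growth\<close>

text \<open>Taking 2^k-th roots removes the constant \<open>D\<close> in the limit. If y < x, a
  number z strictly between them is positive even for y = 0, and (x / z)^(2^n) outgrows
  \<open>max D 1\<close>.\<close>

lemma le_if_powers_of_two_le:
  fixes x y D :: real
  assumes "0 \<le> y" and le: "\<And>k. x ^ (2 ^ k) \<le> D * y ^ (2 ^ k)"
  shows "x \<le> y"
proof (rule ccontr)
  assume "\<not> x \<le> y"
  then have xy: "y < x" by simp
  obtain z where z: "y < z" "z < x"
    using dense[OF xy] by blast
  have z0: "0 < z" using assms(1) z by simp
  obtain n where n: "max D 1 < (x / z) ^ n"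
    using real_arch_pow[of "x / z" "max D 1"] z z0 by auto
  have "(x / z) ^ n \<le> (x / z) ^ (2 ^ n)"
    using z z0 by (intro power_increasing) (auto simp: less_imp_le)
  then have "max D 1 < x ^ (2 ^ n) / z ^ (2 ^ n)"
    using n by (simp add: power_divide)
  then have "max D 1 * z ^ (2 ^ n) < x ^ (2 ^ n)"
    using pos_less_divide_eq[of "z ^ (2 ^ n)"] z0 by (metis zero_less_power)
  also have "\<dots> \<le> D * y ^ (2 ^ n)" by (rule le)
  also have "\<dots> \<le> max D 1 * z ^ (2 ^ n)"
    using z assms(1) by (intro mult_mono power_mono) auto
  finally show False by simp
qed

definition square_positive :: "('a::{real_algebra_1, comm_ring_1} \<Rightarrow> real) \<Rightarrow> bool" where
  "square_positive \<psi> \<longleftrightarrow> linear \<psi> \<and> (\<forall>c. 0 \<le> \<psi> (c\<^sup>2))"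

text \<open>The value of \<psi> at (t a + s b)^2 is a non-negative quadratic form in t and
  s.\<close>

lemma square_positive_Cauchy_Schwarz:
  assumes "square_positive \<psi>"
  shows "(\<psi> (a * b))\<^sup>2 \<le> \<psi> (a\<^sup>2) * \<psi> (b\<^sup>2)"
proof -
  have lin: "linear \<psi>" and pos: "\<And>c. 0 \<le> \<psi> (c\<^sup>2)"
    using assms by (auto simp: square_positive_def)
  note [simp] = linear_add[OF lin] linear_diff[OF lin] linear_scale[OF lin]
  have quad: "0 \<le> \<psi> (a\<^sup>2) * t\<^sup>2 + 2 * \<psi> (a * b) * t * s + \<psi> (b\<^sup>2) * s\<^sup>2" for t s :: real
  proof -
    have "(t *\<^sub>R a + s *\<^sub>R b)\<^sup>2 = t\<^sup>2 *\<^sub>R a\<^sup>2 + s\<^sup>2 *\<^sub>R b\<^sup>2 +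
        ((t * s) *\<^sub>R (a * b) + (t * s) *\<^sub>R (a * b))"
      by (simp add: power2_eq_square distrib_left distrib_right ac_simps)
    then have "\<psi> ((t *\<^sub>R a + s *\<^sub>R b)\<^sup>2) = t\<^sup>2 * \<psi> (a\<^sup>2) + s\<^sup>2 * \<psi> (b\<^sup>2) +
        (t * s * \<psi> (a * b) + t * s * \<psi> (a * b))"
      by (simp only: linear_add[OF lin] linear_scale[OF lin] real_scaleR_def)
    then show ?thesis using pos[of "t *\<^sub>R a + s *\<^sub>R b"] by (simp add: algebra_simps)
  qed
  show ?thesis
  proof (cases "\<psi> (a\<^sup>2) = 0")
    case True
    have "\<psi> (a * b) = 0"
    proof (rule ccontr)
      assume nz: "\<psi> (a * b) \<noteq> 0"
      \<comment> \<open>With s = 1 this value of t makes the form equal to -1, as its term in t^2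
        vanishes.\<close>
      have "2 * \<psi> (a * b) * (- (\<psi> (b\<^sup>2) + 1) / (2 * \<psi> (a * b))) = - (\<psi> (b\<^sup>2) + 1)"
        using nz by simp
      then show False
        using quad[of "- (\<psi> (b\<^sup>2) + 1) / (2 * \<psi> (a * b))" 1] True by simp
    qed
    then show ?thesis using True by simp
  next
    case False
    then have "0 < \<psi> (a\<^sup>2)" using pos[of a] by simp
    \<comment> \<open>At t = - \<psi> (a b) and s = \<psi> (a^2) the form is \<psi> (a^2) times the
      difference of the two sides of the claim.\<close>
    moreover have "0 \<le> \<psi> (a\<^sup>2) * (\<psi> (a\<^sup>2) * \<psi> (b\<^sup>2) - (\<psi> (a * b))\<^sup>2)"
      using quad[of "- \<psi> (a * b)" "\<psi> (a\<^sup>2)"] by (simp add: power2_eq_square algebra_simps)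
    ultimately show ?thesis by (simp add: zero_le_mult_iff)
  qed
qed

text \<open>Iterating (\<psi> c)^2 <= \<psi> 1 * \<psi> (c^2) bounds the 2^k-th power of |\<psi> c|
  / \<psi> 1 by |\<psi> (c^(2^k))| / \<psi> 1. The growth hypothesis applies to the latter, and in
  the limit \<open>D\<close> gives way to the constant \<open>\<psi> 1\<close>.\<close>

lemma square_positive_bound:
  assumes \<psi>: "square_positive \<psi>" and "0 \<le> q"
    and growth: "\<And>k. \<psi> (c ^ (2 ^ k)) \<le> D * q ^ (2 ^ k)"
  shows "\<bar>\<psi> c\<bar> \<le> \<psi> 1 * q"
proof -
  have one: "0 \<le> \<psi> 1"
    using \<psi> unfolding square_positive_def by (metis one_power2)
  have CS: "(\<psi> a)\<^sup>2 \<le> \<psi> 1 * \<psi> (a\<^sup>2)" for a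
    using square_positive_Cauchy_Schwarz[OF \<psi>, of 1 a] by simp
  show ?thesis
  proof (cases "\<psi> 1 = 0")
    case True
    then show ?thesis using CS[of c] by simp
  next
    case False
    with one have one: "0 < \<psi> 1" by simp
    have iter: "(\<bar>\<psi> c\<bar> / \<psi> 1) ^ (2 ^ k) \<le> \<bar>\<psi> (c ^ (2 ^ k))\<bar> / \<psi> 1" for k
    proof (induction k)
      case (Suc k)
      have "(\<bar>\<psi> c\<bar> / \<psi> 1) ^ (2 ^ Suc k) = ((\<bar>\<psi> c\<bar> / \<psi> 1) ^ (2 ^ k))\<^sup>2"
        by (simp add: power_mult[symmetric] mult.commute)
      also have "\<dots> \<le> (\<bar>\<psi> (c ^ (2 ^ k))\<bar> / \<psi> 1)\<^sup>2"
        using Suc one by (intro power_mono) auto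
      also have "\<dots> = (\<psi> (c ^ (2 ^ k)))\<^sup>2 / (\<psi> 1)\<^sup>2"
        by (simp add: power_divide)
      also have "\<dots> \<le> \<psi> 1 * \<psi> ((c ^ (2 ^ k))\<^sup>2) / (\<psi> 1)\<^sup>2"
        using CS one by (intro divide_right_mono) auto
      also have "\<dots> = \<psi> (c ^ (2 ^ Suc k)) / \<psi> 1"
        using one by (simp add: power2_eq_square power_add[symmetric] mult_2)
      also have "\<dots> \<le> \<bar>\<psi> (c ^ (2 ^ Suc k))\<bar> / \<psi> 1"
        using one by (intro divide_right_mono) auto
      finally show ?case .
    qed simp
    \<comment> \<open>For k > 0 the argument is a square, so the absolute value changes nothing. The
      second entry of the maximum covers k = 0.\<close>
    have even_bound: "\<bar>\<psi> (c ^ (2 ^ k))\<bar> \<le> max D (\<bar>\<psi> c\<bar> / q) * q ^ (2 ^ k)" if "0 < q" for k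
    proof (cases k)
      case 0
      then show ?thesis using that by (simp add: pos_divide_le_eq[symmetric])
    next
      case (Suc m)
      have "0 \<le> \<psi> ((c ^ (2 ^ m))\<^sup>2)" using \<psi> by (simp add: square_positive_def)
      then have "0 \<le> \<psi> (c ^ (2 ^ k))"
        by (simp add: Suc power_mult[symmetric] mult.commute)
      then show ?thesis
        using growth[of k] that by (auto intro: order_trans mult_right_mono)
    qed
    show ?thesis
    proof (cases "q = 0")
      \<comment> \<open>The constant in \<open>even_bound\<close> divides by q, so q = 0 is treated
        apart; growth at k = 1 suffices.\<close>
      case True
      have "\<psi> (c\<^sup>2) \<le> 0" using growth[of 1] True by simp
      then have "\<psi> 1 * \<psi> (c\<^sup>2) \<le> 0" using one by (simp add: mult_nonneg_nonpos)
      then have "(\<psi> c)\<^sup>2 \<le> 0" using CS[of c] by linarith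
      then show ?thesis using True by simp
    next
      case False
      then have q: "0 < q" using assms by simp
      have "\<bar>\<psi> c\<bar> / \<psi> 1 \<le> q"
      proof (rule le_if_powers_of_two_le[OF \<open>0 \<le> q\<close>])
        fix k
        show "(\<bar>\<psi> c\<bar> / \<psi> 1) ^ (2 ^ k) \<le> (max D (\<bar>\<psi> c\<bar> / q) / \<psi> 1) * q ^ (2 ^ k)"
          using iter[of k] divide_right_mono[OF even_bound[OF q, of k], of "\<psi> 1"] one by simp
      qed
      then show ?thesis using one by (simp add: pos_divide_le_eq mult.commute)
    qed
  qed
qed

lemma closed_linear: "closed {\<phi>::'a::real_vector \<Rightarrow> real. linear \<phi>}"
proof -
  have "{\<phi>::'a \<Rightarrow> real. linear \<phi>} =
    {\<phi>. \<forall>x y. \<phi> (x + y) = \<phi> x + \<phi> y} \<inter> {\<phi>. \<forall>r x. \<phi> (r *\<^sub>R x) = r * \<phi> x}"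
    by (auto simp: linear_iff)
  also have "closed \<dots>"
    by (intro closed_Int closed_Collect_all closed_Collect_eq continuous_intros continuous_on_coordinate)
  finally show ?thesis .
qed

lemma closed_character_space: "closed (character_space :: ('a::{real_algebra_1, comm_ring_1} \<Rightarrow> real) set)"
proof -
  have "(character_space :: ('a \<Rightarrow> real) set) =
    {\<alpha>. linear \<alpha>} \<inter> {\<alpha>. \<alpha> 1 = 1} \<inter> {\<alpha>. \<forall>a b. \<alpha> (a * b) = \<alpha> a * \<alpha> b}"
    by (auto simp: character_space_def)
  also have "closed \<dots>"
    by (intro closed_Int closed_linear closed_Collect_all closed_Collect_eq continuous_intros
        continuous_on_coordinate)
  finally show ?thesis .
qed

lemma linear_mult_functional:
  fixes \<phi> :: "'a::real_algebra \<Rightarrow> real"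
  assumes "linear \<phi>"
  shows "linear (\<lambda>c. \<phi> (d * c))"
  using assms by (auto simp: linear_iff distrib_left)

section \<open>Compactness of the state space and multiplicativity of extreme states\<close>

locale growth_bound =
  fixes p :: "'a::{real_algebra_1, comm_ring_1} \<Rightarrow> real"
  assumes p_nonneg: "0 \<le> p a"
    and p_power: "p (a ^ n) \<le> p a ^ n"
begin

definition states :: "('a \<Rightarrow> real) set" where
  "states = {\<phi>. square_positive \<phi> \<and> \<phi> 1 = 1 \<and> (\<forall>c. \<bar>\<phi> c\<bar> \<le> p c)}"

definition bounded_characters :: "('a \<Rightarrow> real) set" where
  "bounded_characters = {\<alpha>\<in>character_space. \<forall>a. \<bar>\<alpha> a\<bar> \<le> p a}"

lemma compact_box: "compact {\<phi>::'a \<Rightarrow> real. \<forall>c. \<bar>\<phi> c\<bar> \<le> p c}"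
proof -
  have "compactin (product_topology (\<lambda>c. euclidean) UNIV) (\<Pi>\<^sub>E c\<in>UNIV. {- p c .. p c})"
    by (subst compactin_PiE) auto
  moreover have "(\<Pi>\<^sub>E c\<in>UNIV. {- p c .. p c}) = {\<phi>. \<forall>c. \<bar>\<phi> c\<bar> \<le> p c}"
    by (auto simp: PiE_def Pi_def abs_le_iff minus_le_iff)
  ultimately show ?thesis
    by (simp add: euclidean_product_topology)
qed

lemma compact_bounded_characters: "compact bounded_characters"
proof -
  have "bounded_characters = {\<phi>. \<forall>c. \<bar>\<phi> c\<bar> \<le> p c} \<inter> character_space"
    by (auto simp: bounded_characters_def)
  then show ?thesis
    by (simp add: compact_Int_closed compact_box closed_character_space)
qed

lemma compact_states: "compact states"
proof -
  have "states = {\<phi>. \<forall>c. \<bar>\<phi> c\<bar> \<le> p c} \<inter>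
      ({\<phi>. linear \<phi>} \<inter> {\<phi>. \<forall>c. 0 \<le> \<phi> (c\<^sup>2)} \<inter> {\<phi>. \<phi> 1 = 1})"
    by (auto simp: states_def square_positive_def)
  moreover have "closed ({\<phi>::'a \<Rightarrow> real. linear \<phi>} \<inter> {\<phi>. \<forall>c. 0 \<le> \<phi> (c\<^sup>2)} \<inter> {\<phi>. \<phi> 1 = 1})"
    by (intro closed_Int closed_linear closed_Collect_all closed_Collect_eq closed_Collect_le
        continuous_intros continuous_on_coordinate)
  ultimately show ?thesis
    by (simp add: compact_Int_closed compact_box)
qed

text \<open>Positivity holds because s^2 c^2 = (s c)^2. Cauchy-Schwarz and \<open>p_power\<close>
  bound \<phi> (s^2 c^(2^k)) by a multiple of p c ^ 2^k, and \<open>square_positive_bound\<close>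
  turns the factor into \<phi> (s^2).\<close>

lemma state_mult_square:
  assumes "\<phi> \<in> states"
  shows "square_positive (\<lambda>c. \<phi> (s\<^sup>2 * c))" and "\<bar>\<phi> (s\<^sup>2 * c)\<bar> \<le> \<phi> (s\<^sup>2) * p c"
proof -
  have \<phi>: "square_positive \<phi>" and le: "\<And>c. \<bar>\<phi> c\<bar> \<le> p c"
    using assms by (auto simp: states_def)
  have pos: "\<And>c. 0 \<le> \<phi> (c\<^sup>2)" and lin: "linear \<phi>"
    using \<phi> by (auto simp: square_positive_def)
  show sp: "square_positive (\<lambda>c. \<phi> (s\<^sup>2 * c))"
    using pos[of "s * _"] linear_mult_functional[OF lin]
    by (auto simp: square_positive_def power_mult_distrib)
  have "\<bar>\<phi> (s\<^sup>2 * c)\<bar> \<le> \<phi> (s\<^sup>2 * 1) * p c"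
  proof (rule square_positive_bound[OF sp])
    show "0 \<le> p c" by (rule p_nonneg)
    fix k
    have "(\<phi> (s\<^sup>2 * c ^ (2 ^ k)))\<^sup>2 \<le> \<phi> ((s\<^sup>2)\<^sup>2) * \<phi> ((c ^ (2 ^ k))\<^sup>2)"
      by (rule square_positive_Cauchy_Schwarz[OF \<phi>])
    also have "\<dots> \<le> \<phi> ((s\<^sup>2)\<^sup>2) * (p c ^ 2 ^ k)\<^sup>2"
    proof (intro mult_left_mono pos)
      show "\<phi> ((c ^ (2 ^ k))\<^sup>2) \<le> (p c ^ 2 ^ k)\<^sup>2"
        using le[of "c ^ (2 ^ k * 2)"] p_power[of c "2 ^ k * 2"] by (simp add: power_mult)
    qed
    also have "\<dots> = (sqrt (\<phi> ((s\<^sup>2)\<^sup>2)) * p c ^ 2 ^ k)\<^sup>2"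
      using pos[of "s\<^sup>2"] by (simp add: power_mult_distrib)
    finally show "\<phi> (s\<^sup>2 * c ^ (2 ^ k)) \<le> sqrt (\<phi> ((s\<^sup>2)\<^sup>2)) * p c ^ 2 ^ k"
      by (rule power2_le_imp_le)
        (intro mult_nonneg_nonneg real_sqrt_ge_zero zero_le_power pos p_nonneg)
  qed
  then show "\<bar>\<phi> (s\<^sup>2 * c)\<bar> \<le> \<phi> (s\<^sup>2) * p c" by simp
qed

text \<open>The element r^2 - s^2 need not be a square, but acts like one: \<phi> (s^2 c^2) <=
  \<phi> (c^2) p (s^2) <= \<phi> (c^2) r^2, where the first inequality is
  \<open>state_mult_square\<close> with weight c^2 and argument s^2. Strictness of p s < r allows
  normalization.\<close>

lemma square_positive_complement:
  assumes "\<phi> \<in> states" and r: "p s < r"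
  shows "square_positive (\<lambda>c. \<phi> ((r\<^sup>2 *\<^sub>R 1 - s\<^sup>2) * c))"
    and "0 < \<phi> (r\<^sup>2 *\<^sub>R 1 - s\<^sup>2)"
    and "\<bar>\<phi> ((r\<^sup>2 *\<^sub>R 1 - s\<^sup>2) * c)\<bar> \<le> \<phi> (r\<^sup>2 *\<^sub>R 1 - s\<^sup>2) * p c"
proof -
  have \<phi>: "square_positive \<phi>" "\<phi> 1 = 1" and le: "\<And>c. \<bar>\<phi> c\<bar> \<le> p c"
    using assms by (auto simp: states_def)
  have pos: "\<And>c. 0 \<le> \<phi> (c\<^sup>2)" and lin: "linear \<phi>"
    using \<phi> by (auto simp: square_positive_def)
  note [simp] = linear_diff[OF lin] linear_scale[OF lin]
  have rs: "(p s)\<^sup>2 < r\<^sup>2"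
    using r p_nonneg[of s] by (intro power_strict_mono) auto
  have expand: "\<phi> ((r\<^sup>2 *\<^sub>R 1 - s\<^sup>2) * c) = r\<^sup>2 * \<phi> c - \<phi> (s\<^sup>2 * c)" for c
    by (simp add: left_diff_distrib)
  have "\<phi> (s\<^sup>2) \<le> (p s)\<^sup>2"
    using le[of "s\<^sup>2"] p_power[of s 2] by linarith
  then show "0 < \<phi> (r\<^sup>2 *\<^sub>R 1 - s\<^sup>2)"
    using rs \<phi> by simp
  have "0 \<le> \<phi> ((r\<^sup>2 *\<^sub>R 1 - s\<^sup>2) * c\<^sup>2)" for c
  proof -
    have "\<phi> (s\<^sup>2 * c\<^sup>2) \<le> \<phi> (c\<^sup>2) * p (s\<^sup>2)"
      using state_mult_square(2)[OF assms(1), of c "s\<^sup>2"] by (simp add: mult.commute)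
    also have "\<dots> \<le> \<phi> (c\<^sup>2) * r\<^sup>2"
      using pos p_power[of s 2] rs by (intro mult_left_mono) auto
    finally show ?thesis
      unfolding expand by (simp add: mult.commute)
  qed
  then show sp: "square_positive (\<lambda>c. \<phi> ((r\<^sup>2 *\<^sub>R 1 - s\<^sup>2) * c))"
    using linear_mult_functional[OF lin] by (auto simp: square_positive_def)
  have "\<bar>\<phi> ((r\<^sup>2 *\<^sub>R 1 - s\<^sup>2) * c)\<bar> \<le> \<phi> ((r\<^sup>2 *\<^sub>R 1 - s\<^sup>2) * 1) * p c"
  proof (rule square_positive_bound[OF sp p_nonneg])
    fix k
    have "\<phi> ((r\<^sup>2 *\<^sub>R 1 - s\<^sup>2) * c ^ 2 ^ k) \<le> r\<^sup>2 * p (c ^ 2 ^ k) + \<phi> (s\<^sup>2) * p (c ^ 2 ^ k)"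
      using mult_left_mono[OF abs_le_D1[OF le[of "c ^ 2 ^ k"]], of "r\<^sup>2"]
        state_mult_square(2)[OF assms(1), of s "c ^ 2 ^ k"]
      unfolding expand by (auto simp: abs_mult abs_le_iff)
    also have "\<dots> = (r\<^sup>2 + \<phi> (s\<^sup>2)) * p (c ^ 2 ^ k)"
      by (simp add: distrib_right)
    also have "\<dots> \<le> (r\<^sup>2 + \<phi> (s\<^sup>2)) * p c ^ 2 ^ k"
      using pos p_power by (intro mult_left_mono) auto
    finally show "\<phi> ((r\<^sup>2 *\<^sub>R 1 - s\<^sup>2) * c ^ 2 ^ k) \<le> (r\<^sup>2 + \<phi> (s\<^sup>2)) * p c ^ 2 ^ k" .
  qed
  then show "\<bar>\<phi> ((r\<^sup>2 *\<^sub>R 1 - s\<^sup>2) * c)\<bar> \<le> \<phi> (r\<^sup>2 *\<^sub>R 1 - s\<^sup>2) * p c" by simp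
qed

lemma normalized_state:
  assumes "square_positive \<psi>" "0 < \<psi> 1" "\<And>c. \<bar>\<psi> c\<bar> \<le> \<psi> 1 * p c"
  shows "(\<lambda>c. \<psi> c / \<psi> 1) \<in> states"
proof -
  have "linear (\<lambda>c. \<psi> c / \<psi> 1)"
    using assms(1) by (auto simp: square_positive_def linear_iff add_divide_distrib)
  then show ?thesis
    using assms by (auto simp: states_def square_positive_def pos_divide_le_eq mult.commute)
qed

text \<open>
  An extreme state \<open>\<phi>\<close> is a convex combination of the states proportional to \<open>c \<mapsto> \<phi> (s\<^sup>2 * c)\<close> and
  \<open>c \<mapsto> \<phi> ((r\<^sup>2 - s\<^sup>2) * c)\<close>, hence is proportional to each of them.
\<close>

lemma extreme_state_character:
  assumes \<phi>: "\<phi> \<in> states"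
    and extreme: "\<And>t \<psi> \<xi>. \<psi> \<in> states \<Longrightarrow> \<xi> \<in> states \<Longrightarrow> convex_split t \<phi> \<psi> \<xi> \<Longrightarrow> \<psi> = \<phi>"
  shows "\<phi> \<in> bounded_characters"
proof -
  have pos: "\<And>c. 0 \<le> \<phi> (c\<^sup>2)" and lin: "linear \<phi>" and one: "\<phi> 1 = 1" and le: "\<And>c. \<bar>\<phi> c\<bar> \<le> p c"
    using \<phi> by (auto simp: square_positive_def states_def)
  note [simp] = linear_diff[OF lin] linear_scale[OF lin] linear_add[OF lin]
  have square: "\<phi> (s\<^sup>2 * c) = \<phi> (s\<^sup>2) * \<phi> c" for s c
  proof (cases "\<phi> (s\<^sup>2) = 0")
    case True
    then show ?thesis using state_mult_square(2)[OF \<phi>, of s c] by simp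
  next
    case False
    then have ps: "0 < \<phi> (s\<^sup>2)" using pos[of s] by simp
    define r where "r = p s + 1"
    have r: "p s < r" "0 < r" using p_nonneg[of s] by (auto simp: r_def)
    define \<psi> where "\<psi> = (\<lambda>c. \<phi> (s\<^sup>2 * c) / \<phi> (s\<^sup>2 * 1))"
    define \<xi> where "\<xi> = (\<lambda>c. \<phi> ((r\<^sup>2 *\<^sub>R 1 - s\<^sup>2) * c) / \<phi> ((r\<^sup>2 *\<^sub>R 1 - s\<^sup>2) * 1))"
    note C = square_positive_complement[OF \<phi> r(1)]
    have "\<psi> \<in> states"
      unfolding \<psi>_def by (rule normalized_state) (use state_mult_square[OF \<phi>] ps in auto)
    moreover have "\<xi> \<in> states"
      unfolding \<xi>_def using C by (intro normalized_state) (simp_all del: linear_diff[OF lin])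
    \<comment> \<open>The weights come from s^2 + (r^2 - s^2) = r^2: they are the normalizing
      factors \<phi> (s^2) and r^2 - \<phi> (s^2), divided by r^2.\<close>
    moreover have "convex_split (\<phi> (s\<^sup>2) / r\<^sup>2) \<phi> \<psi> \<xi>"
    proof -
      have d: "0 < r\<^sup>2 - \<phi> (s\<^sup>2)" using C(2) one by simp
      have "\<phi> x = \<phi> (s\<^sup>2) / r\<^sup>2 * \<psi> x + (1 - \<phi> (s\<^sup>2) / r\<^sup>2) * \<xi> x" for x
      proof -
        have "1 - \<phi> (s\<^sup>2) / r\<^sup>2 = (r\<^sup>2 - \<phi> (s\<^sup>2)) / r\<^sup>2"
          using r by (simp add: diff_divide_distrib)
        moreover have "\<xi> x = (r\<^sup>2 * \<phi> x - \<phi> (s\<^sup>2 * x)) / (r\<^sup>2 - \<phi> (s\<^sup>2))"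
          by (simp add: \<xi>_def left_diff_distrib one)
        ultimately have "(1 - \<phi> (s\<^sup>2) / r\<^sup>2) * \<xi> x = (r\<^sup>2 * \<phi> x - \<phi> (s\<^sup>2 * x)) / r\<^sup>2"
          using d r by simp
        moreover have "\<phi> (s\<^sup>2) / r\<^sup>2 * \<psi> x = \<phi> (s\<^sup>2 * x) / r\<^sup>2"
          using ps by (simp add: \<psi>_def)
        ultimately show ?thesis
          using r by (simp add: diff_divide_distrib)
      qed
      moreover have "0 < \<phi> (s\<^sup>2) / r\<^sup>2" "\<phi> (s\<^sup>2) / r\<^sup>2 < 1"
        using d ps r by simp_all
      ultimately show ?thesis
        unfolding convex_split_def by blast
    qed
    ultimately have "\<psi> = \<phi>" by (rule extreme)
    then have "\<psi> c = \<phi> c" by simp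
    then show ?thesis using ps by (simp add: \<psi>_def field_simps)
  qed
  have "\<phi> (a * b) = \<phi> a * \<phi> b" for a b
  proof -
    \<comment> \<open>Up to the factor 4 every element is a difference of two squares, so
      \<open>square\<close> extends by linearity.\<close>
    have polar: "4 *\<^sub>R a = (1 + a)\<^sup>2 - (1 - a)\<^sup>2"
      by (simp add: power2_eq_square algebra_simps scaleR_conv_of_real)
    then have "4 *\<^sub>R a * b = (1 + a)\<^sup>2 * b - (1 - a)\<^sup>2 * b"
      by (simp add: left_diff_distrib)
    then have "\<phi> (4 *\<^sub>R a * b) = \<phi> ((1 + a)\<^sup>2 - (1 - a)\<^sup>2) * \<phi> b"
      using square[of "1 + a" b] square[of "1 - a" b] by (simp add: left_diff_distrib)
    then show ?thesis
      unfolding polar[symmetric] by simp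
  qed
  then show ?thesis
    using lin one le by (auto simp: bounded_characters_def character_space_def)
qed

text \<open>An extreme minimizer of the coordinate \<open>a\<close> among the states is a character,
  and L is one of the competitors.\<close>

theorem state_ge_bounded_character:
  assumes "L \<in> states"
  obtains \<alpha> where "\<alpha> \<in> bounded_characters" "\<alpha> a \<le> L a"
proof -
  obtain \<phi> where \<phi>: "\<phi> \<in> states" "\<And>\<psi>. \<psi> \<in> states \<Longrightarrow> \<phi> a \<le> \<psi> a"
    "\<And>t \<psi> \<xi>. \<psi> \<in> states \<Longrightarrow> \<xi> \<in> states \<Longrightarrow> convex_split t \<phi> \<psi> \<xi> \<Longrightarrow> \<psi> = \<phi>"
    using ex_extreme_minimizer[OF compact_states, of a] assms by (metis empty_iff)
  show thesis
  proof (rule that)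
    show "\<phi> \<in> bounded_characters"
      using \<phi>(1,3) by (rule extreme_state_character)
    show "\<phi> a \<le> L a"
      using \<phi>(2) assms .
  qed
qed

end

section \<open>The Riesz representation theorem on a compact Hausdorff space\<close>

text \<open>A compact Hausdorff subspace is normal, so Urysohn's lemma applies inside
  \<open>K\<close>; hence h is continuous only on \<open>K\<close>.\<close>

lemma compact_Urysohn:
  fixes K :: "'x::t2_space set"
  assumes K: "compact K" and AB: "compact A" "compact B" "A \<subseteq> K" "B \<subseteq> K" "A \<inter> B = {}"
  obtains h :: "'x \<Rightarrow> real" where "continuous_on K h" "\<And>x. x \<in> K \<Longrightarrow> 0 \<le> h x \<and> h x \<le> 1"
    "\<And>x. x \<in> A \<Longrightarrow> h x = 0" "\<And>x. x \<in> B \<Longrightarrow> h x = 1"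
proof -
  have "Hausdorff_space (euclidean :: 'x topology)"
    unfolding Hausdorff_space_def using hausdorff by (fastforce simp: disjnt_def)
  then have "Hausdorff_space (top_of_set K)"
    by (rule Hausdorff_space_subtopology)
  moreover have "compact_space (top_of_set K)"
    using K by (simp add: compact_space_subtopology)
  ultimately have "normal_space (top_of_set K)"
    using compact_Hausdorff_or_regular_imp_normal_space by blast
  moreover have "closedin (top_of_set K) A" "closedin (top_of_set K) B"
    using AB by (auto intro: closed_subset compact_imp_closed)
  moreover have "disjnt A B"
    using AB by (simp add: disjnt_def)
  ultimately obtain h where h: "continuous_map (top_of_set K) (top_of_set {0..1::real}) h"
      "h ` A \<subseteq> {0}" "h ` B \<subseteq> {1}"
    using Urysohn_lemma[of "top_of_set K" A B 0 1] by (metis zero_le_one)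
  show ?thesis
  proof (rule that)
    show "continuous_on K h" "\<And>x. x \<in> K \<Longrightarrow> 0 \<le> h x \<and> h x \<le> 1"
      using h(1) by (auto simp: continuous_map_in_subtopology Pi_iff image_subset_iff)
  qed (use h in auto)
qed

lemma compact_superlevel:
  fixes K :: "'x::t2_space set" and f :: "'x \<Rightarrow> real"
  assumes "compact K" "continuous_on K f"
  shows "compact {x\<in>K. d \<le> f x}"
proof -
  have "closed {x\<in>K. f x \<in> {d..}}"
    using assms by (intro continuous_closed_preimage[unfolded vimage_def Int_def mem_Collect_eq])
      (auto simp: compact_imp_closed)
  then have "compact (K \<inter> {x\<in>K. d \<le> f x})"
    using assms by (intro compact_Int_closed) auto
  moreover have "K \<inter> {x\<in>K. d \<le> f x} = {x\<in>K. d \<le> f x}"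
    by auto
  ultimately show ?thesis
    by simp
qed

text \<open>The functional accepts all functions, but the axioms concern those continuous on
  \<open>K\<close>. Positivity is tested on \<open>K\<close> alone, so two such functions that agree
  on \<open>K\<close> get the same value.\<close>

locale positive_functional_on =
  fixes \<Lambda> :: "('x::t2_space \<Rightarrow> real) \<Rightarrow> real" and K :: "'x set"
  assumes compact_K: "compact K"
    and add: "continuous_on K f \<Longrightarrow> continuous_on K g \<Longrightarrow> \<Lambda> (\<lambda>x. f x + g x) = \<Lambda> f + \<Lambda> g"
    and scale: "continuous_on K f \<Longrightarrow> \<Lambda> (\<lambda>x. c * f x) = c * \<Lambda> f"
    and pos: "continuous_on K f \<Longrightarrow> (\<And>x. x \<in> K \<Longrightarrow> 0 \<le> f x) \<Longrightarrow> 0 \<le> \<Lambda> f"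
begin

lemma diff:
  assumes "continuous_on K f" "continuous_on K g"
  shows "\<Lambda> (\<lambda>x. f x - g x) = \<Lambda> f - \<Lambda> g"
  using add[OF assms(1), of "\<lambda>x. (-1) * g x"] scale[OF assms(2), of "-1"] assms
  by (simp add: continuous_on_minus)

lemma mono:
  assumes "continuous_on K f" "continuous_on K g" "\<And>x. x \<in> K \<Longrightarrow> f x \<le> g x"
  shows "\<Lambda> f \<le> \<Lambda> g"
proof -
  have "0 \<le> \<Lambda> (\<lambda>x. g x - f x)"
    using assms by (intro pos continuous_intros) auto
  then show ?thesis
    using diff[OF assms(2,1)] by simp
qed

lemma zero: "\<Lambda> (\<lambda>x. 0) = 0"
  using scale[of "\<lambda>x. 0" 0] by simp

lemma const: "\<Lambda> (\<lambda>x. c) = c * \<Lambda> (\<lambda>x. 1)"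
  using scale[of "\<lambda>x. 1" c] by simp

lemma total_nonneg: "0 \<le> \<Lambda> (\<lambda>x. 1)"
  by (rule pos) auto

lemma sum_functional:
  assumes "\<And>i. continuous_on K (g i)"
  shows "\<Lambda> (\<lambda>x. \<Sum>i<n::nat. g i x) = (\<Sum>i<n. \<Lambda> (g i))"
proof (induction n)
  case (Suc n)
  then show ?case
    using add[of "\<lambda>x. \<Sum>i<n. g i x" "g n"] assms by (simp add: continuous_on_sum)
qed (simp add: zero)

text \<open>
  Only the values of \<open>f\<close>, not its support, are confined to \<open>U\<close>; since \<open>f\<close> can be cut off at a small
  level, the supremum defining \<open>content\<close> is the same.
\<close>

definition below :: "'x set \<Rightarrow> ('x \<Rightarrow> real) set" where
  "below U = {f. continuous_on K f \<and> (\<forall>x\<in>K. 0 \<le> f x \<and> f x \<le> 1) \<and> (\<forall>x\<in>K - U. f x = 0)}"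

definition content :: "'x set \<Rightarrow> ennreal" where
  "content U = (SUP f\<in>below U. ennreal (\<Lambda> f))"

definition outer :: "'x set \<Rightarrow> ennreal" where
  "outer E = (INF U\<in>{U. open U \<and> E \<subseteq> U}. content U)"

section \<open>Content of open sets and the outer measure\<close>

lemma zero_below: "(\<lambda>x. 0) \<in> below U"
  by (simp add: below_def)

lemma below_nonneg: "f \<in> below U \<Longrightarrow> 0 \<le> \<Lambda> f"
  by (rule pos) (auto simp: below_def)

lemma content_upper: "f \<in> below U \<Longrightarrow> ennreal (\<Lambda> f) \<le> content U"
  unfolding content_def by (rule SUP_upper)

lemma content_mono: "U \<subseteq> V \<Longrightarrow> content U \<le> content V"
  unfolding content_def by (rule SUP_subset_mono) (auto simp: below_def)

lemma content_null:
  assumes "K \<inter> U = {}"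
  shows "content U = 0"
proof -
  have "ennreal (\<Lambda> f) \<le> 0" if "f \<in> below U" for f
  proof -
    have "\<Lambda> f \<le> \<Lambda> (\<lambda>x. 0)"
    proof (rule mono)
      show "f x \<le> 0" if "x \<in> K" for x
        using that assms \<open>f \<in> below U\<close> by (force simp: below_def)
    qed (use that in \<open>auto simp: below_def\<close>)
    then show ?thesis by (simp add: zero ennreal_neg)
  qed
  then show ?thesis
    unfolding content_def by (metis SUP_least le_zero_eq)
qed

lemma content_UNIV: "content UNIV = ennreal (\<Lambda> (\<lambda>x. 1))"
proof (rule antisym)
  show "content UNIV \<le> ennreal (\<Lambda> (\<lambda>x. 1))"
    unfolding content_def by (intro SUP_least ennreal_leI mono) (auto simp: below_def)
  show "ennreal (\<Lambda> (\<lambda>x. 1)) \<le> content UNIV"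
    by (rule content_upper) (auto simp: below_def)
qed

lemma content_finite: "content U < \<infinity>"
  using content_mono[of U UNIV] by (auto simp: content_UNIV intro: le_less_trans)

lemma outer_open: "open U \<Longrightarrow> outer U = content U"
  unfolding outer_def by (intro antisym INF_lower2[of U] INF_greatest content_mono) auto

lemma outer_mono: "E \<subseteq> F \<Longrightarrow> outer E \<le> outer F"
  unfolding outer_def by (rule INF_superset_mono) auto

lemma outer_le_content: "open U \<Longrightarrow> E \<subseteq> U \<Longrightarrow> outer E \<le> content U"
  unfolding outer_def by (rule INF_lower) auto

lemma outer_finite: "outer E < \<infinity>"
  using outer_le_content[of UNIV E] content_finite[of UNIV] by (auto intro: le_less_trans)

text \<open>The cut-off function vanishes outside the compact set where \<open>d \<le> f x\<close>.\<close>

lemma cut_off: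
  assumes "continuous_on K f" "0 < e"
  obtains d where "0 < d" "\<Lambda> f \<le> \<Lambda> (\<lambda>x. max 0 (f x - d)) + e"
proof
  define d where "d = e / (\<Lambda> (\<lambda>x. 1) + 1)"
  show "0 < d"
    using assms total_nonneg by (simp add: d_def)
  have "\<Lambda> f \<le> \<Lambda> (\<lambda>x. max 0 (f x - d) + d)"
    using assms by (intro mono continuous_intros) auto
  also have "\<dots> = \<Lambda> (\<lambda>x. max 0 (f x - d)) + d * \<Lambda> (\<lambda>x. 1)"
    using assms by (subst add) (auto intro!: continuous_intros simp: const[of d])
  also have "d * \<Lambda> (\<lambda>x. 1) \<le> e"
    using assms total_nonneg by (simp add: d_def field_simps)
  finally show "\<Lambda> f \<le> \<Lambda> (\<lambda>x. max 0 (f x - d)) + e"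
    by simp
qed

text \<open>A partition of unity. Cutting f off at level d confines it to a compact set C inside the
  union; C - U and C - V are then disjoint compact sets, and a Urysohn function h splits the cut-off
  function into parts below U and below V.\<close>

lemma content_Un:
  assumes "open U" "open V"
  shows "content (U \<union> V) \<le> content U + content V"
  unfolding content_def[of "U \<union> V"]
proof (rule SUP_least, rule ennreal_le_epsilon)
  fix f and e :: real
  assume f: "f \<in> below (U \<union> V)" and e: "0 < e"
  then have cf: "continuous_on K f" by (simp add: below_def)
  obtain d where d: "0 < d" "\<Lambda> f \<le> \<Lambda> (\<lambda>x. max 0 (f x - d)) + e"
    using cut_off[OF cf e] .
  let ?C = "{x\<in>K. d \<le> f x}"
  have C: "compact ?C"
    using compact_superlevel[OF compact_K cf] .
  have sub: "?C \<subseteq> U \<union> V"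
    using f d(1) by (force simp: below_def)
  obtain h :: "'x \<Rightarrow> real" where h: "continuous_on K h" "\<And>x. x \<in> K \<Longrightarrow> 0 \<le> h x \<and> h x \<le> 1"
    "\<And>x. x \<in> ?C - U \<Longrightarrow> h x = 0" "\<And>x. x \<in> ?C - V \<Longrightarrow> h x = 1"
  proof (rule compact_Urysohn[OF compact_K, of "?C - U" "?C - V"])
    show "compact (?C - U)" "compact (?C - V)"
      using C assms by (auto intro: compact_diff)
    show "(?C - U) \<inter> (?C - V) = {}"
      using sub by blast
    fix h :: "'x \<Rightarrow> real"
    assume "continuous_on K h" "\<And>x. x \<in> K \<Longrightarrow> 0 \<le> h x \<and> h x \<le> 1"
      "\<And>x. x \<in> ?C - U \<Longrightarrow> h x = 0" "\<And>x. x \<in> ?C - V \<Longrightarrow> h x = 1"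
    then show thesis by (rule that)
  qed auto
  let ?g = "\<lambda>x. max 0 (f x - d)"
  have g: "0 \<le> ?g x" "?g x \<le> 1" if "x \<in> K" for x
    using f d that by (auto simp: below_def)
  have cg: "continuous_on K ?g"
    using cf by (intro continuous_intros)
  have U: "(\<lambda>x. ?g x * h x) \<in> below U"
    unfolding below_def
  proof (intro CollectI conjI ballI)
    show "continuous_on K (\<lambda>x. ?g x * h x)"
      using cg h(1) by (rule continuous_on_mult)
    show "0 \<le> ?g x * h x" "?g x * h x \<le> 1" if "x \<in> K" for x
      using g[OF that] h(2)[OF that] by (auto intro: mult_le_one)
    show "?g x * h x = 0" if "x \<in> K - U" for x
      using h(3)[of x] that by (cases "d \<le> f x") auto
  qed
  have V: "(\<lambda>x. ?g x * (1 - h x)) \<in> below V"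
    unfolding below_def
  proof (intro CollectI conjI ballI)
    show "continuous_on K (\<lambda>x. ?g x * (1 - h x))"
      using cf h(1) by (intro continuous_intros)
    show "0 \<le> ?g x * (1 - h x)" "?g x * (1 - h x) \<le> 1" if "x \<in> K" for x
      using g[OF that] h(2)[OF that] by (auto intro: mult_le_one)
    show "?g x * (1 - h x) = 0" if "x \<in> K - V" for x
      using h(4)[of x] that by (cases "d \<le> f x") auto
  qed
  have "\<Lambda> ?g = \<Lambda> (\<lambda>x. ?g x * h x + ?g x * (1 - h x))"
    by (simp add: right_diff_distrib)
  also have "\<dots> = \<Lambda> (\<lambda>x. ?g x * h x) + \<Lambda> (\<lambda>x. ?g x * (1 - h x))"
    using cf h(1) by (intro add continuous_intros)
  finally have "ennreal (\<Lambda> f) \<le> ennreal (\<Lambda> (\<lambda>x. ?g x * h x) + \<Lambda> (\<lambda>x. ?g x * (1 - h x)) + e)"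
    using d by (intro ennreal_leI) simp
  also have "\<dots> = ennreal (\<Lambda> (\<lambda>x. ?g x * h x)) + ennreal (\<Lambda> (\<lambda>x. ?g x * (1 - h x))) + ennreal e"
    using below_nonneg[OF U] below_nonneg[OF V] e by simp
  also have "\<dots> \<le> content U + content V + ennreal e"
    by (intro add_mono content_upper U V order_refl)
  finally show "ennreal (\<Lambda> f) \<le> content U + content V + ennreal e" .
qed

lemma content_finite_UN:
  assumes "\<And>i. open (U i)"
  shows "content (\<Union>i<n::nat. U i) \<le> (\<Sum>i<n. content (U i))"
proof (induction n)
  case (Suc n)
  have "content (\<Union>i<Suc n. U i) \<le> content (\<Union>i<n. U i) + content (U n)"
    using content_Un[of "\<Union>i<n. U i" "U n"] assms
    by (simp add: lessThan_Suc Un_commute open_UN)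
  also have "\<dots> \<le> (\<Sum>i<Suc n. content (U i))"
    using Suc by (simp add: add_right_mono)
  finally show ?case .
qed (simp add: content_null)

text \<open>The cut-off function lives on a compact part of the union, so finitely many of the sets
  suffice and finite subadditivity applies.\<close>

lemma content_UN:
  assumes U: "\<And>i::nat. open (U i)"
  shows "content (\<Union>i. U i) \<le> (\<Sum>i. content (U i))"
  unfolding content_def[of "\<Union>i. U i"]
proof (rule SUP_least, rule ennreal_le_epsilon)
  fix f and e :: real
  assume f: "f \<in> below (\<Union>i. U i)" and e: "0 < e"
  then have cf: "continuous_on K f" by (simp add: below_def)
  obtain d where d: "0 < d" "\<Lambda> f \<le> \<Lambda> (\<lambda>x. max 0 (f x - d)) + e"
    using cut_off[OF cf e] .
  have "{x\<in>K. d \<le> f x} \<subseteq> (\<Union>i. U i)"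
    using f d(1) by (force simp: below_def)
  then obtain I where I: "finite I" "{x\<in>K. d \<le> f x} \<subseteq> (\<Union>i\<in>I. U i)"
    using compactE_image[OF compact_superlevel[OF compact_K cf], of UNIV U d] U by metis
  obtain n where n: "I \<subseteq> {..<n}"
    using finite_nat_iff_bounded I(1) by blast
  have below: "(\<lambda>x. max 0 (f x - d)) \<in> below (\<Union>i<n. U i)"
    unfolding below_def
  proof (intro CollectI conjI ballI)
    show "continuous_on K (\<lambda>x. max 0 (f x - d))"
      using cf by (intro continuous_intros)
    show "0 \<le> max 0 (f x - d)" "max 0 (f x - d) \<le> 1" if "x \<in> K" for x
      using f d that by (auto simp: below_def)
    show "max 0 (f x - d) = 0" if "x \<in> K - (\<Union>i<n. U i)" for x
      using that I(2) n by fastforce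
  qed
  have "ennreal (\<Lambda> f) \<le> ennreal (\<Lambda> (\<lambda>x. max 0 (f x - d)) + e)"
    using d by (intro ennreal_leI)
  also have "\<dots> = ennreal (\<Lambda> (\<lambda>x. max 0 (f x - d))) + ennreal e"
    using below_nonneg[OF below] e by simp
  also have "\<dots> \<le> (\<Sum>i<n. content (U i)) + ennreal e"
    using content_upper[OF below] content_finite_UN[where U = U and n = n, OF U] by (auto intro: add_right_mono order_trans)
  also have "\<dots> \<le> (\<Sum>i. content (U i)) + ennreal e"
    by (intro add_right_mono sum_le_suminf) auto
  finally show "ennreal (\<Lambda> f) \<le> (\<Sum>i. content (U i)) + ennreal e" .
qed

section \<open>Caratheodory's construction of the Borel measure\<close>

lemma outer_measure_space_outer: "outer_measure_space UNIV outer"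
proof -
  have "countably_subadditive UNIV outer"
    unfolding countably_subadditive_def
  proof (intro allI impI)
    fix A :: "nat \<Rightarrow> 'x set"
    show "outer (\<Union>i. A i) \<le> (\<Sum>i. outer (A i))"
    proof (rule ennreal_le_epsilon)
      fix e :: real
      assume e: "0 < e"
      \<comment> \<open>The errors e / 2^(n+1) sum up to e. Finiteness of \<open>outer (A n)\<close>
        makes the inequality that produces U strict.\<close>
      have "\<exists>U. open U \<and> A n \<subseteq> U \<and> content U < outer (A n) + ennreal (e * (1/2) ^ Suc n)" for n
      proof -
        have "outer (A n) < outer (A n) + ennreal (e * (1/2) ^ Suc n)"
          using outer_finite[of "A n"] e by (simp add: ennreal_less_zero_iff less_top)
        then show ?thesis
          unfolding outer_def[of "A n"] INF_less_iff by auto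
      qed
      then obtain U where U: "\<And>n. open (U n)" "\<And>n. A n \<subseteq> U n"
          "\<And>n. content (U n) < outer (A n) + ennreal (e * (1/2) ^ Suc n)"
        by metis
      have "outer (\<Union>i. A i) \<le> content (\<Union>i. U i)"
        using U by (intro outer_le_content) auto
      also have "\<dots> \<le> (\<Sum>i. content (U i))"
        using U(1) by (rule content_UN)
      also have "\<dots> \<le> (\<Sum>i. outer (A i) + ennreal (e * (1/2) ^ Suc i))"
        using U(3) by (intro suminf_le summableI) (simp add: less_imp_le)
      also have "\<dots> = (\<Sum>i. outer (A i)) + (\<Sum>i. ennreal e * ennreal ((1/2) ^ Suc i))"
        using e by (subst suminf_add[symmetric])
          (auto simp del: ennreal_suminf_cmult simp add: ennreal_mult[symmetric])
      also have "(\<Sum>i. ennreal e * ennreal ((1/2) ^ Suc i)) = ennreal e"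
        unfolding ennreal_suminf_cmult
        by (subst suminf_ennreal_eq[OF zero_le_power power_half_series]) auto
      finally show "outer (\<Union>i. A i) \<le> (\<Sum>i. outer (A i)) + ennreal e" .
    qed
  qed
  then show ?thesis
    by (auto simp: outer_measure_space_def positive_def increasing_def outer_mono outer_open
        content_null)
qed

text \<open>Caratheodory's condition is tested on an open V containing E. A function f below the
  intersection of U and V is cut off, and the compact set where d <= f is removed from V. The
  remaining W is open and contains V - U, and a function below W can be added to the cut-off
  function without exceeding 1.\<close>

lemma open_lambda_system:
  assumes U: "open U"
  shows "U \<in> lambda_system UNIV UNIV outer"
proof -
  interpret ring_of_sets UNIV "Pow (UNIV :: 'x set)"
    by (rule ring_of_sets_Pow)
  have sub: "subadditive UNIV outer"
    using outer_measure_space_outer countably_subadditive_subadditive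
    by (simp add: outer_measure_space_def)
  have "outer (U \<inter> E) + outer ((UNIV - U) \<inter> E) = outer E" for E
  proof (rule antisym)
    have "outer ((U \<inter> E) \<union> ((UNIV - U) \<inter> E)) \<le> outer (U \<inter> E) + outer ((UNIV - U) \<inter> E)"
      using sub by (rule subadditiveD) auto
    moreover have "(U \<inter> E) \<union> ((UNIV - U) \<inter> E) = E" by auto
    ultimately show "outer E \<le> outer (U \<inter> E) + outer ((UNIV - U) \<inter> E)" by simp
    show "outer (U \<inter> E) + outer ((UNIV - U) \<inter> E) \<le> outer E"
      unfolding outer_def[of E]
    proof (rule INF_greatest, clarify)
      fix V
      assume V: "open V" "E \<subseteq> V"
      have "outer (U \<inter> E) + outer ((UNIV - U) \<inter> E) \<le> content (U \<inter> V) + outer (V - U)"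
        using U V by (intro add_mono outer_le_content outer_mono) auto
      also have "\<dots> = (SUP f\<in>below (U \<inter> V). ennreal (\<Lambda> f) + outer (V - U))"
        unfolding content_def using zero_below by (intro ennreal_SUP_add_left[symmetric]) auto
      also have "\<dots> \<le> content V"
      proof (rule SUP_least, rule ennreal_le_epsilon)
        fix f and e :: real
        assume f: "f \<in> below (U \<inter> V)" and e: "0 < e"
        then have cf: "continuous_on K f" by (simp add: below_def)
        obtain d where d: "0 < d" "\<Lambda> f \<le> \<Lambda> (\<lambda>x. max 0 (f x - d)) + e"
          using cut_off[OF cf e] .
        let ?f = "\<lambda>x. max 0 (f x - d)"
        define W where "W = V - {x\<in>K. d \<le> f x}"
        have "open W"
          unfolding W_def using V compact_superlevel[OF compact_K cf]
          by (intro open_Diff compact_imp_closed)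
        moreover have "V - U \<subseteq> W"
          using f d(1) by (force simp: W_def below_def)
        ultimately have "ennreal (\<Lambda> f) + outer (V - U) \<le> ennreal (\<Lambda> f) + content W"
          by (intro add_left_mono outer_le_content)
        also have "\<dots> = (SUP g\<in>below W. ennreal (\<Lambda> f) + ennreal (\<Lambda> g))"
          unfolding content_def using zero_below by (intro ennreal_SUP_add_right) auto
        also have "\<dots> \<le> content V + ennreal e"
        proof (rule SUP_least)
          fix g
          assume g: "g \<in> below W"
          have below: "(\<lambda>x. ?f x + g x) \<in> below V"
            unfolding below_def
          proof (intro CollectI conjI ballI)
            show "continuous_on K (\<lambda>x. ?f x + g x)"
              using cf g by (intro continuous_intros) (auto simp: below_def)
            fix x
            assume x: "x \<in> K"
            show "0 \<le> ?f x + g x"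
              using g x by (auto simp: below_def)
            show "?f x + g x \<le> 1"
            proof (cases "d \<le> f x")
              case True
              then have "g x = 0" using x g by (auto simp: below_def W_def)
              then show ?thesis using f x d(1) True by (auto simp: below_def)
            next
              case False
              then show ?thesis using g x by (auto simp: below_def)
            qed
          next
            show "?f x + g x = 0" if "x \<in> K - V" for x
              using f g d(1) that by (auto simp: below_def W_def)
          qed
          have "ennreal (\<Lambda> f) + ennreal (\<Lambda> g) = ennreal (\<Lambda> f + \<Lambda> g)"
            using below_nonneg f g by simp
          also have "\<Lambda> (\<lambda>x. ?f x + g x) = \<Lambda> ?f + \<Lambda> g"
            using cf g by (intro add continuous_intros) (auto simp: below_def)
          then have "ennreal (\<Lambda> f + \<Lambda> g) \<le> ennreal (\<Lambda> (\<lambda>x. ?f x + g x) + e)"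
            using d by (intro ennreal_leI) simp
          also have "\<dots> \<le> content V + ennreal e"
            using content_upper[OF below] below_nonneg[OF below] e by (simp add: add_right_mono)
          finally show "ennreal (\<Lambda> f) + ennreal (\<Lambda> g) \<le> content V + ennreal e" .
        qed
        finally show "ennreal (\<Lambda> f) + outer (V - U) \<le> content V + ennreal e" .
      qed
      finally show "outer (U \<inter> E) + outer ((UNIV - U) \<inter> E) \<le> content V" .
    qed
  qed
  then show ?thesis
    by (simp add: lambda_system_def)
qed

lemma measure_space_outer: "measure_space UNIV (sets borel) outer"
proof -
  interpret sigma_algebra UNIV "Pow (UNIV :: 'x set)"
    by (rule sigma_algebra_Pow)
  have ms: "measure_space UNIV (lambda_system UNIV UNIV outer) outer"
    using caratheodory_lemma[of outer] outer_measure_space_outer by simp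
  then interpret ls: sigma_algebra UNIV "lambda_system UNIV UNIV outer"
    by (simp add: measure_space_def)
  have "sets borel \<subseteq> lambda_system UNIV UNIV outer"
    unfolding sets_borel using open_lambda_system by (intro ls.sigma_sets_subset) auto
  then show ?thesis
    using sets.sigma_algebra_axioms[of borel] by (intro measure_down[OF ms]) auto
qed

section \<open>Regularity of the Riesz measure and integration against it\<close>

definition riesz_measure :: "'x measure" where
  "riesz_measure = measure_of UNIV (sets borel) outer"

lemma sets_riesz_measure [simp, measurable_cong]: "sets riesz_measure = sets borel"
  unfolding riesz_measure_def using sets.sigma_sets_eq[of borel] by simp

lemma space_riesz_measure [simp]: "space riesz_measure = UNIV"
  by (simp add: riesz_measure_def space_measure_of_conv)

lemma emeasure_riesz_measure: "B \<in> sets borel \<Longrightarrow> emeasure riesz_measure B = outer B"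
  unfolding riesz_measure_def using measure_space_outer
  by (intro emeasure_measure_of_sigma) (auto simp: measure_space_def)

lemma emeasure_open: "open U \<Longrightarrow> emeasure riesz_measure U = content U"
  by (simp add: emeasure_riesz_measure outer_open)

sublocale riesz: finite_measure riesz_measure
  using content_finite[of UNIV] by (intro finite_measureI) (simp add: emeasure_open less_top)

lemma closed_K: "closed K"
  using compact_K by (rule compact_imp_closed)

lemma emeasure_outside_K: "emeasure riesz_measure (- K) = 0"
  using emeasure_open[of "- K"] content_null[of "- K"] closed_K by (simp add: open_Compl)

lemma AE_in_K: "AE x in riesz_measure. x \<in> K"
  using emeasure_outside_K closed_K by (intro AE_I[of _ _ "- K"]) auto

lemma measure_total: "measure riesz_measure UNIV = \<Lambda> (\<lambda>x. 1)"
  using total_nonneg by (simp add: measure_def emeasure_open content_UNIV)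

text \<open>The definition of \<open>outer\<close> gives outer regularity. Applied to the complement
  of B it yields an open U around that complement with small excess; K - U is then a compact subset
  of B that misses little of it, because \<open>K\<close> carries all the mass.\<close>

lemma inner_regular:
  assumes B: "B \<in> sets borel"
  shows "emeasure riesz_measure B = (SUP C\<in>{C. compact C \<and> C \<subseteq> B}. emeasure riesz_measure C)"
proof (rule antisym)
  show "(SUP C\<in>{C. compact C \<and> C \<subseteq> B}. emeasure riesz_measure C) \<le> emeasure riesz_measure B"
    using B by (intro SUP_least emeasure_mono) auto
  show "emeasure riesz_measure B \<le> (SUP C\<in>{C. compact C \<and> C \<subseteq> B}. emeasure riesz_measure C)"
  proof (rule ennreal_le_epsilon)
    fix e :: real
    assume e: "0 < e"
    have "outer (- B) < outer (- B) + ennreal e"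
      using outer_finite[of "- B"] e by (simp add: ennreal_less_zero_iff less_top)
    then obtain U where U: "open U" "- B \<subseteq> U" "content U < outer (- B) + ennreal e"
      unfolding outer_def[of "- B"] INF_less_iff by auto
    have mB: "- B \<in> sets borel"
      using B by (rule borel_comp)
    have "emeasure riesz_measure (U - - B) = emeasure riesz_measure U - emeasure riesz_measure (- B)"
      by (rule emeasure_Diff) (use U mB in simp_all)
    also have "\<dots> = content U - outer (- B)"
      using U(1) by (simp only: emeasure_open emeasure_riesz_measure[OF mB])
    also have "\<dots> \<le> ennreal e"
      using U(3) content_finite[of U]
      by (simp add: ennreal_minus_le_iff add.commute less_imp_le less_top[symmetric])
    finally have small: "emeasure riesz_measure (U - - B) \<le> ennreal e" .
    have "emeasure riesz_measure B \<le> emeasure riesz_measure ((K - U) \<union> (- K) \<union> (U - - B))"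
      using B U(1) closed_K by (intro emeasure_mono) auto
    also have "\<dots> \<le> emeasure riesz_measure ((K - U) \<union> (- K)) + emeasure riesz_measure (U - - B)"
      using B U(1) closed_K by (intro emeasure_subadditive) auto
    also have "\<dots> \<le> emeasure riesz_measure (K - U) + emeasure riesz_measure (- K) + ennreal e"
      using small U(1) closed_K by (intro add_mono emeasure_subadditive) auto
    also have "\<dots> = emeasure riesz_measure (K - U) + ennreal e"
      by (simp add: emeasure_outside_K)
    also have "emeasure riesz_measure (K - U) \<le> (SUP C\<in>{C. compact C \<and> C \<subseteq> B}. emeasure riesz_measure C)"
      using U compact_K by (intro SUP_upper) (auto intro: compact_diff)
    finally show "emeasure riesz_measure B \<le>
        (SUP C\<in>{C. compact C \<and> C \<subseteq> B}. emeasure riesz_measure C) + ennreal e"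
      by (simp add: add_right_mono)
  qed
qed

lemma integrable_riesz_measure:
  assumes "continuous_on UNIV f"
  shows "integrable riesz_measure (f :: 'x \<Rightarrow> real)"
proof -
  have "bounded (f ` K)"
    using assms compact_K
    by (intro compact_imp_bounded compact_continuous_image) (auto intro: continuous_on_subset)
  then obtain B where "\<And>x. x \<in> K \<Longrightarrow> norm (f x) \<le> B"
    by (auto simp: bounded_iff)
  then have "AE x in riesz_measure. norm (f x) \<le> B"
    using AE_in_K by auto
  moreover have "f \<in> borel_measurable riesz_measure"
    using borel_measurable_continuous_onI[OF assms] by (simp cong: measurable_cong_sets)
  ultimately show ?thesis
    by (rule riesz.integrable_const_bound)
qed

text \<open>
  Slicing: \<open>n * f\<close> is the sum of the layers \<open>min 1 (max 0 (n * f - i))\<close> for \<open>i < n\<close>. The \<open>i\<close>-th layer is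
  below the set \<open>V i\<close> where \<open>i < n * f\<close>, and a point lies in at most \<open>n * f + 1\<close> of these sets.
\<close>

lemma functional_le_integral:
  assumes f: "continuous_on UNIV f" and f01: "\<And>x. x \<in> K \<Longrightarrow> 0 \<le> f x \<and> f x \<le> 1"
  shows "\<Lambda> f \<le> (\<integral>x. f x \<partial>riesz_measure)"
proof (rule field_le_epsilon)
  fix e :: real
  assume e: "0 < e"
  have cK: "continuous_on K g" if "continuous_on UNIV g" for g :: "'x \<Rightarrow> real"
    using that by (rule continuous_on_subset) auto
  \<comment> \<open>The count of layers overshoots n f by at most 1, which integrates to
    \<open>\<Lambda> (\<lambda>x. 1)\<close>; for this n that is less than e after division by
    n.\<close>
  obtain n :: nat where "\<Lambda> (\<lambda>x. 1) / e < real n"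
    using reals_Archimedean2 by blast
  then have n: "\<Lambda> (\<lambda>x. 1) < e * real n"
    using e by (simp add: pos_divide_less_eq mult.commute)
  then have n0: "0 < n"
    using total_nonneg by (cases n) auto
  define g where "g i x = min 1 (max 0 (real n * f x - real i))" for i :: nat and x
  define V where "V i = {x. real i < real n * f x}" for i :: nat
  have cg: "continuous_on UNIV (g i)" for i
    unfolding g_def using f by (intro continuous_intros)
  have open_V: "open (V i)" for i
    unfolding V_def using f by (intro open_Collect_less continuous_intros)
  have g_sum: "(\<Sum>i<m. min 1 (max 0 (y - real i))) = y" if "0 \<le> y" "y \<le> real m" for m y
    using that
  proof (induction m arbitrary: y)
    case (Suc m)
    show ?case
    proof (cases "y \<le> real m")
      case True
      then show ?thesis using Suc by simp
    next
      case False
      then have "(\<Sum>i<m. min 1 (max 0 (y - real i))) = (\<Sum>i<m. 1)"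
        by (intro sum.cong) auto
      then show ?thesis using Suc.prems False by simp
    qed
  qed auto
  \<comment> \<open>Membership in \<open>V m\<close> forces n f x > m, so even counting all of the
    first m + 1 sets stays within the bound. The maximum handles points outside \<open>K\<close>,
    where f may be negative.\<close>
  have count: "(\<Sum>i<m. indicator (V i) x) \<le> max 0 (real n * f x) + (1::real)" for m x
  proof (induction m)
    case (Suc m)
    show ?case
    proof (cases "x \<in> V m")
      case True
      have "(\<Sum>i<Suc m. indicator (V i) x) \<le> (\<Sum>i<Suc m. (1::real))"
        by (intro sum_mono) (auto simp: indicator_def)
      also have "\<dots> \<le> max 0 (real n * f x) + 1"
        using True by (simp add: V_def)
      finally show ?thesis .
    qed (use Suc in simp)
  qed simp
  have "\<Lambda> (g i) \<le> measure riesz_measure (V i)" for i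
  proof -
    have "g i \<in> below (V i)"
      using cK[OF cg] by (auto simp: below_def g_def V_def)
    then have "ennreal (\<Lambda> (g i)) \<le> ennreal (measure riesz_measure (V i))"
      using content_upper emeasure_open[OF open_V] by (simp add: riesz.emeasure_eq_measure)
    then show ?thesis by simp
  qed
  then have "(\<Sum>i<n. \<Lambda> (g i)) \<le> (\<Sum>i<n. measure riesz_measure (V i))"
    by (rule sum_mono)
  also have "\<dots> = (\<integral>x. (\<Sum>i<n. indicator (V i) x) \<partial>riesz_measure)"
    using open_V by (subst Bochner_Integration.integral_sum) (auto simp: riesz.emeasure_eq_measure)
  also have "\<dots> \<le> (\<integral>x. real n * f x + 1 \<partial>riesz_measure)"
  proof (rule integral_mono_AE)
    show "integrable riesz_measure (\<lambda>x. (\<Sum>i<n. indicator (V i) x) :: real)"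
      using open_V by (intro Bochner_Integration.integrable_sum)
        (auto simp: riesz.emeasure_eq_measure)
    show "integrable riesz_measure (\<lambda>x. real n * f x + 1)"
      using f by (intro integrable_riesz_measure continuous_intros)
    show "AE x in riesz_measure. (\<Sum>i<n. indicator (V i) x) \<le> real n * f x + 1"
      using AE_in_K
    proof eventually_elim
      case (elim x)
      then show ?case using count[where m = n and x = x] f01[of x] by (simp add: max_def split: if_splits)
    qed
  qed
  also have "\<dots> = real n * (\<integral>x. f x \<partial>riesz_measure) + \<Lambda> (\<lambda>x. 1)"
    using integrable_riesz_measure[OF f] by (simp add: measure_total)
  also have "(\<Sum>i<n. \<Lambda> (g i)) = \<Lambda> (\<lambda>x. \<Sum>i<n. g i x)"
    using cK[OF cg] by (rule sum_functional[symmetric])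
  also have "\<dots> = \<Lambda> (\<lambda>x. real n * f x)"
  proof -
    have "(\<Sum>i<n. g i x) = real n * f x" if "x \<in> K" for x
      unfolding g_def using f01[OF that] by (intro g_sum) (auto simp: mult_left_le)
    then show ?thesis
      using cK cg f by (intro antisym mono continuous_on_sum) (auto intro!: continuous_intros)
  qed
  also have "\<dots> = real n * \<Lambda> f"
    using cK[OF f] by (rule scale)
  finally have "real n * \<Lambda> f \<le> real n * ((\<integral>x. f x \<partial>riesz_measure) + e)"
    using n by (simp add: algebra_simps)
  then show "\<Lambda> f \<le> (\<integral>x. f x \<partial>riesz_measure) + e"
    using n0 by simp
qed

text \<open>An affine rescaling g of f takes values in [0, 1] on \<open>K\<close>. Applying
  \<open>functional_le_integral\<close> to g and to 1 - g gives both inequalities, since functional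
  and integral agree on constants.\<close>

theorem integral_riesz_measure:
  assumes f: "continuous_on UNIV f"
  shows "(\<integral>x. f x \<partial>riesz_measure) = \<Lambda> f"
proof -
  have cK: "continuous_on K g" if "continuous_on UNIV g" for g :: "'x \<Rightarrow> real"
    using that by (rule continuous_on_subset) auto
  have "bounded (f ` K)"
    using cK[OF f] compact_K by (intro compact_imp_bounded compact_continuous_image)
  then obtain B where B: "0 < B" "\<And>x. x \<in> K \<Longrightarrow> \<bar>f x\<bar> \<le> B"
    by (auto simp: bounded_pos)
  define g where "g x = 1 / (2 * B) * (f x + B)" for x
  have g: "continuous_on UNIV g"
    unfolding g_def using f by (intro continuous_intros)
  have g01: "0 \<le> g x \<and> g x \<le> 1" if "x \<in> K" for x
    using B(1) B(2)[OF that] by (auto simp: g_def field_simps)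
  have "\<Lambda> g \<le> (\<integral>x. g x \<partial>riesz_measure)"
    using g g01 by (rule functional_le_integral)
  moreover have "\<Lambda> (\<lambda>x. 1 - g x) \<le> (\<integral>x. 1 - g x \<partial>riesz_measure)"
    using g g01 by (intro functional_le_integral) (auto intro!: continuous_intros)
  moreover have "\<Lambda> (\<lambda>x. 1 - g x) = \<Lambda> (\<lambda>x. 1) - \<Lambda> g"
    using cK[OF g] by (intro diff) auto
  moreover have "(\<integral>x. 1 - g x \<partial>riesz_measure) = \<Lambda> (\<lambda>x. 1) - (\<integral>x. g x \<partial>riesz_measure)"
    using integrable_riesz_measure[OF g] by (simp add: measure_total)
  ultimately have "\<Lambda> g = (\<integral>x. g x \<partial>riesz_measure)"
    by linarith
  moreover have "\<Lambda> g = 1 / (2 * B) * (\<Lambda> f + B * \<Lambda> (\<lambda>x. 1))"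
    unfolding g_def using cK[OF f]
    by (subst scale, intro continuous_intros) (auto simp: add const[of B])
  moreover have "(\<integral>x. g x \<partial>riesz_measure) = 1 / (2 * B) * ((\<integral>x. f x \<partial>riesz_measure) + B * \<Lambda> (\<lambda>x. 1))"
    unfolding g_def using integrable_riesz_measure[OF f] by (simp add: measure_total)
  ultimately show ?thesis
    using B(1) by simp
qed

end

section \<open>Compactly supported representing measures\<close>

lemma character_power: "\<alpha> \<in> character_space \<Longrightarrow> \<alpha> (a ^ n) = \<alpha> a ^ n"
  by (induction n) (auto simp: character_space_def)

lemma character_scaleR_one:
  assumes "\<alpha> \<in> character_space"
  shows "\<alpha> (c *\<^sub>R 1) = c"
  using assms linear_scale[of \<alpha> c 1] by (simp add: character_space_def)

text \<open>The Stone-Weierstrass theorem: on characters, evaluations add and multiply as the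
  algebra elements do, multiples of 1 give the constants, and points are separated.\<close>

lemma character_approximation:
  fixes Z :: "('a::{real_algebra_1, comm_ring_1} \<Rightarrow> real) set"
  assumes Z: "compact Z" "Z \<subseteq> character_space" and f: "continuous_on Z f" and "0 < e"
  obtains a where "\<And>\<alpha>. \<alpha> \<in> Z \<Longrightarrow> \<bar>f \<alpha> - \<alpha> a\<bar> < e"
proof -
  \<comment> \<open>Agreement is asked only on Z, since sums, products and constants are evaluations
    on characters but not on all functions.\<close>
  let ?R = "{g. \<exists>a. \<forall>\<alpha>\<in>Z. g \<alpha> = \<alpha> a}"
  have char: "linear \<alpha>" "\<alpha> (a * b) = \<alpha> a * \<alpha> b" if "\<alpha> \<in> Z" for \<alpha> a b
    using that Z(2) by (auto simp: character_space_def)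
  interpret function_ring_on ?R Z
  proof
    show "compact Z" by fact
    show "continuous_on Z g" if g: "g \<in> ?R" for g
    proof -
      obtain a where "\<forall>\<alpha>\<in>Z. g \<alpha> = \<alpha> a" using g by blast
      then have "continuous_on Z g = continuous_on Z (\<lambda>\<alpha>. \<alpha> a)"
        by (intro continuous_on_cong) auto
      then show ?thesis by (simp add: continuous_on_coordinate)
    qed
    fix g h
    assume "g \<in> ?R" "h \<in> ?R"
    then obtain a b where ab: "\<forall>\<alpha>\<in>Z. g \<alpha> = \<alpha> a" "\<forall>\<alpha>\<in>Z. h \<alpha> = \<alpha> b" by blast
    have "\<forall>\<alpha>\<in>Z. g \<alpha> + h \<alpha> = \<alpha> (a + b)" "\<forall>\<alpha>\<in>Z. g \<alpha> * h \<alpha> = \<alpha> (a * b)"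
      using ab char by (auto simp: linear_add)
    then show "(\<lambda>x. g x + h x) \<in> ?R" "(\<lambda>x. g x * h x) \<in> ?R" by blast+
  next
    fix c :: real
    have "\<forall>\<alpha>\<in>Z. c = \<alpha> (c *\<^sub>R 1)"
      using Z(2) by (auto simp: character_scaleR_one subset_iff)
    then show "(\<lambda>_. c) \<in> ?R" by blast
  next
    fix \<alpha> \<beta> :: "'a \<Rightarrow> real"
    assume "\<alpha> \<noteq> \<beta>"
    then obtain a where "\<alpha> a \<noteq> \<beta> a" by blast
    then show "\<exists>f\<in>?R. f \<alpha> \<noteq> f \<beta>" by (intro bexI[of _ "\<lambda>\<gamma>. \<gamma> a"]) auto
  qed
  obtain g where "g \<in> ?R" "\<forall>\<alpha>\<in>Z. \<bar>f \<alpha> - g \<alpha>\<bar> < e"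
    using Stone_Weierstrass_basic[OF f \<open>0 < e\<close>] by blast
  then obtain a where "\<forall>\<alpha>\<in>Z. \<bar>f \<alpha> - \<alpha> a\<bar> < e" by auto
  then show thesis using that by blast
qed

lemma compactin_character_topology:
  "compactin character_topology C \<longleftrightarrow> compact C \<and> C \<subseteq> character_space"
  by (auto simp: character_topology_eq_subtopology compactin_subtopology)

lemma closedin_character_topology:
  "closedin character_topology C \<longleftrightarrow> closed C \<and> C \<subseteq> character_space"
  by (simp add: character_topology_eq_subtopology closedin_closed_eq[OF closed_character_space]
      conj_commute)

lemma character_space_borel [simp]: "character_space \<in> sets borel"
  using closed_character_space by (rule borel_closed)

lemma sets_character_topology:
  "sigma_sets (topspace character_topology) {U. openin character_topology U} =
    sets (restrict_space borel (character_space :: ('a::{real_algebra_1, comm_ring_1} \<Rightarrow> real) set))"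
proof -
  let ?X = "character_space :: ('a \<Rightarrow> real) set"
  have "{U. openin (top_of_set ?X) U} = (\<inter>) ?X ` {S. open S}"
    by (auto simp: openin_open)
  moreover have "(\<inter>) ?X ` sigma_sets UNIV {S. open S} = sigma_sets ?X ((\<inter>) ?X ` {S. open S})"
    by (intro sigma_sets_Int) (auto simp: sets_borel[symmetric])
  ultimately show ?thesis
    by (simp add: sets_restrict_space sets_borel character_topology_eq_subtopology)
qed

lemma moment_growth_le:
  assumes "0 \<le> B" "\<And>n. 1 \<le> n \<Longrightarrow> L (a ^ (2 * n)) \<le> B ^ (2 * n)"
  shows "moment_growth L a \<le> ereal B"
  unfolding moment_growth_def
proof (rule SUP_least)
  fix n :: nat
  assume "n \<in> {1..}"
  then have n: "1 \<le> n" by simp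
  then have "root (2 * n) (L (a ^ (2 * n))) \<le> root (2 * n) (B ^ (2 * n))"
    using assms by (intro real_root_le_mono) auto
  also have "\<dots> = B"
    using n assms(1) by (intro real_root_power_cancel) auto
  finally show "ereal (root (2 * n) (L (a ^ (2 * n)))) \<le> ereal B" by simp
qed

lemma moment_le_power:
  assumes "moment_growth L a \<le> ereal B" "1 \<le> n" "0 \<le> L (a ^ (2 * n))"
  shows "L (a ^ (2 * n)) \<le> B ^ (2 * n)"
proof -
  have "ereal (root (2 * n) (L (a ^ (2 * n)))) \<le> moment_growth L a"
    unfolding moment_growth_def using assms(2) by (intro SUP_upper) auto
  then have "root (2 * n) (L (a ^ (2 * n))) \<le> B"
    using assms(1) order_trans by fastforce
  then have "root (2 * n) (L (a ^ (2 * n))) ^ (2 * n) \<le> B ^ (2 * n)"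
    using assms by (intro power_mono) (auto simp: real_root_ge_zero)
  then show ?thesis
    using assms by (simp add: real_root_pow_pos2)
qed

section \<open>Moments and support of a compactly supported representing measure\<close>

locale compact_representation =
  fixes L :: "'a::{real_algebra_1, comm_ring_1} \<Rightarrow> real" and \<nu> :: "('a \<Rightarrow> real) measure"
  assumes representing: "representing_radon_measure L \<nu>"
    and compact_support: "compactly_supported character_topology \<nu>"
    and L_one: "L 1 = 1"
begin

abbreviation support :: "('a \<Rightarrow> real) set" where
  "support \<equiv> measure_support character_topology \<nu>"

lemma radon: "radon_measure character_topology \<nu>"
  and integrable_eval: "integrable \<nu> (\<lambda>\<alpha>. \<alpha> a)"
  and integral_eval: "(\<integral>\<alpha>. \<alpha> a \<partial>\<nu>) = L a"
  using representing by (auto simp: representing_radon_measure_def)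

lemma space_eq: "space \<nu> = character_space"
  using radon by (simp add: radon_measure_def)

lemma sets_eq: "sets \<nu> = sets (restrict_space borel character_space)"
  using radon by (simp add: radon_measure_def sets_character_topology[symmetric])

lemma sets_iff: "B \<in> sets \<nu> \<longleftrightarrow> B \<in> sets borel \<and> B \<subseteq> character_space"
  by (simp add: sets_eq sets_restrict_space_iff conj_commute)

lemma support: "compact support" "support \<subseteq> character_space"
  using compact_support by (auto simp: compactly_supported_def compactin_character_topology)

lemma emeasure_space: "emeasure \<nu> (space \<nu>) = 1"
proof -
  have "(\<integral>\<alpha>. \<alpha> 1 \<partial>\<nu>) = (\<integral>\<alpha>. 1 \<partial>\<nu>)"
    by (rule Bochner_Integration.integral_cong) (auto simp: space_eq character_space_def)
  then have "measure \<nu> (space \<nu>) = 1"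
    using integral_eval[of 1] L_one by simp
  then have "enn2real (emeasure \<nu> (space \<nu>)) = 1"
    by (simp add: measure_def)
  \<comment> \<open>The value 1 also excludes infinite mass, because \<open>enn2real\<close> sends
    infinity to 0.\<close>
  then show ?thesis
    by (metis enn2real_top ennreal_1 ennreal_enn2real less_top zero_neq_one)
qed

sublocale finite_measure \<nu>
  by (rule finite_measureI) (simp add: emeasure_space)

lemma measure_space_one: "measure \<nu> (space \<nu>) = 1"
  by (simp add: measure_def emeasure_space)

lemma AE_support: "AE \<alpha> in \<nu>. \<alpha> \<in> support"
proof (rule AE_I)
  show "emeasure \<nu> (character_space - support) = 0"
    using measure_support_radon(2)[OF radon] by simp
  show "character_space - support \<in> sets \<nu>"
    using support by (auto simp: sets_iff compact_imp_closed borel_closed intro!: sets.Diff)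
qed (auto simp: space_eq)

lemma integrable_power: "integrable \<nu> (\<lambda>\<alpha>. \<alpha> a ^ n)"
  using integrable_eval[of "a ^ n"]
  by (subst Bochner_Integration.integrable_cong[OF refl, of _ _ "\<lambda>\<alpha>. \<alpha> (a ^ n)"])
    (auto simp: space_eq character_power)

lemma moment_eq: "L (a ^ n) = (\<integral>\<alpha>. \<alpha> a ^ n \<partial>\<nu>)"
  unfolding integral_eval[symmetric]
  by (rule Bochner_Integration.integral_cong) (auto simp: space_eq character_power)

lemma moment_growth_le_on_support:
  assumes "0 \<le> B" "\<And>\<alpha>. \<alpha> \<in> support \<Longrightarrow> \<bar>\<alpha> a\<bar> \<le> B"
  shows "moment_growth L a \<le> ereal B"
proof (rule moment_growth_le[OF \<open>0 \<le> B\<close>])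
  fix n
  have "L (a ^ (2 * n)) \<le> (\<integral>\<alpha>. B ^ (2 * n) \<partial>\<nu>)"
    unfolding moment_eq
  proof (rule integral_mono_AE)
    show "AE \<alpha> in \<nu>. \<alpha> a ^ (2 * n) \<le> B ^ (2 * n)"
      using AE_support
    proof eventually_elim
      case (elim \<alpha>)
      then have "\<bar>\<alpha> a\<bar> ^ (2 * n) \<le> B ^ (2 * n)"
        using assms by (intro power_mono) auto
      then show ?case by (simp add: power_even_abs)
    qed
  qed (simp_all add: integrable_power)
  then show "L (a ^ (2 * n)) \<le> B ^ (2 * n)"
    by (simp add: measure_space_one)
qed

lemma moment_growth_finite: "moment_growth L a < \<infinity>"
proof -
  have "bounded ((\<lambda>\<alpha>. \<alpha> a) ` support)"
    by (intro compact_imp_bounded compact_continuous_image continuous_on_coordinate support)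
  then obtain B where "0 < B" "\<And>\<alpha>. \<alpha> \<in> support \<Longrightarrow> \<bar>\<alpha> a\<bar> \<le> B"
    by (auto simp: bounded_pos)
  then have "moment_growth L a \<le> ereal B"
    by (intro moment_growth_le_on_support) auto
  then show ?thesis
    by (rule le_less_trans) simp
qed

text \<open>A Chebyshev argument. If |\<alpha> a| exceeds the growth q, then for some r in between
  the open set U where |\<beta> a| > r has positive measure, and measure U * r^(2n) <= q^(2n) for
  all n >= 1. For large n this contradicts q < r.\<close>

lemma support_subset:
  assumes "\<alpha> \<in> support"
  shows "ereal \<bar>\<alpha> a\<bar> \<le> moment_growth L a"
proof (rule ccontr)
  assume "\<not> ereal \<bar>\<alpha> a\<bar> \<le> moment_growth L a"
  then have "moment_growth L a < ereal \<bar>\<alpha> a\<bar>"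
    by simp
  then obtain r where r: "moment_growth L a < ereal r" "ereal r < ereal \<bar>\<alpha> a\<bar>"
    using ereal_dense2 by blast
  have "ereal 0 \<le> moment_growth L a"
    unfolding moment_growth_def
    by (rule SUP_upper2[of 1]) (auto simp: moment_eq intro!: integral_nonneg_AE)
  then obtain q where q: "moment_growth L a = ereal q" "0 \<le> q" "q < r"
    using r(1) by (cases "moment_growth L a") auto
  define U where "U = character_space \<inter> {\<beta>. r < \<bar>\<beta> a\<bar>}"
  have openU: "openin character_topology U"
    unfolding U_def character_topology_eq_subtopology openin_open
    by (intro exI[of _ "{\<beta>. r < \<bar>\<beta> a\<bar>}"] conjI open_Collect_less continuous_intros
        continuous_on_coordinate) auto
  have U: "U \<in> sets \<nu>"
    using openU radon by (auto simp: radon_measure_def)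
  have "emeasure \<nu> U \<noteq> 0"
  proof
    assume "emeasure \<nu> U = 0"
    then have "support \<subseteq> character_space - U"
      using openU by (intro measure_support_radon(3)[OF radon])
        (auto simp: closedin_def Diff_Diff_Int Int_absorb1 U_def)
    then show False
      using assms support r(2) by (auto simp: U_def)
  qed
  then have pos: "0 < measure \<nu> U"
    by (simp add: emeasure_eq_measure zero_less_measure_iff)
  have le: "measure \<nu> U * r ^ (2 * n) \<le> q ^ (2 * n)" if "1 \<le> n" for n
  proof -
    have "measure \<nu> U * r ^ (2 * n) = (\<integral>\<beta>. indicator U \<beta> * r ^ (2 * n) \<partial>\<nu>)"
      using U by (simp add: Int_absorb1 sets.sets_into_space Int_absorb2)
    also have "\<dots> \<le> (\<integral>\<beta>. \<beta> a ^ (2 * n) \<partial>\<nu>)"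
    proof (rule integral_mono)
      show "integrable \<nu> (\<lambda>\<beta>. indicator U \<beta> * r ^ (2 * n))"
        using U by (simp add: emeasure_eq_measure)
      show "indicator U \<beta> * r ^ (2 * n) \<le> \<beta> a ^ (2 * n)" for \<beta>
      proof (cases "\<beta> \<in> U")
        case True
        then have "r ^ (2 * n) \<le> \<bar>\<beta> a\<bar> ^ (2 * n)"
          using q by (intro power_mono) (auto simp: U_def)
        then show ?thesis using True by (simp add: power_even_abs)
      qed simp
    qed (rule integrable_power)
    also have "\<dots> \<le> q ^ (2 * n)"
      unfolding moment_eq[symmetric]
      by (rule moment_le_power) (use q that in \<open>auto simp: moment_eq intro!: integral_nonneg_AE\<close>)
    finally show ?thesis .
  qed
  have "r\<^sup>2 \<le> q\<^sup>2"
  \<comment> \<open>All exponents are even, so the comparison is made for the squares, with n =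
    2^k.\<close>
  proof (rule le_if_powers_of_two_le)
    fix k :: nat
    show "(r\<^sup>2) ^ 2 ^ k \<le> (1 / measure \<nu> U) * (q\<^sup>2) ^ 2 ^ k"
      using le[of "2 ^ k"] pos by (simp add: power_mult[symmetric] field_simps)
  qed simp
  then show False
    using q by (metis abs_le_square_iff abs_of_nonneg not_less order_trans less_imp_le)
qed

text \<open>A character outside the support is separated from it by a Urysohn function, and up to
  1/3 by the evaluation at some a. The growth at a is then at most 1/3, whereas \<alpha> a >
  2/3.\<close>

lemma subset_support:
  assumes \<alpha>: "\<alpha> \<in> character_space" and le: "\<And>a. ereal \<bar>\<alpha> a\<bar> \<le> moment_growth L a"
  shows "\<alpha> \<in> support"
proof (rule ccontr)
  assume "\<alpha> \<notin> support"
  have Z: "compact (insert \<alpha> support)" "insert \<alpha> support \<subseteq> character_space"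
    using \<alpha> support by auto
  obtain h :: "('a \<Rightarrow> real) \<Rightarrow> real" where h: "continuous_on (insert \<alpha> support) h"
      "\<And>x. x \<in> support \<Longrightarrow> h x = 0" "\<And>x. x \<in> {\<alpha>} \<Longrightarrow> h x = 1"
    by (rule compact_Urysohn[OF Z(1), of support "{\<alpha>}"])
      (use support \<open>\<alpha> \<notin> support\<close> in auto)
  obtain a where a: "\<And>\<beta>. \<beta> \<in> insert \<alpha> support \<Longrightarrow> \<bar>h \<beta> - \<beta> a\<bar> < 1 / 3"
    by (rule character_approximation[OF Z h(1), of "1 / 3"]) auto
  have "moment_growth L a \<le> ereal (1 / 3)"
  proof (rule moment_growth_le_on_support)
    show "\<bar>\<beta> a\<bar> \<le> 1 / 3" if "\<beta> \<in> support" for \<beta>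
      using a[of \<beta>] h(2)[OF that] that by simp
  qed simp
  then have "ereal \<bar>\<alpha> a\<bar> \<le> ereal (1 / 3)"
    using le order_trans by blast
  then have "\<bar>\<alpha> a\<bar> \<le> 1 / 3" by simp
  moreover have "\<bar>1 - \<alpha> a\<bar> < 1 / 3"
    using a[of \<alpha>] h(3)[of \<alpha>] by simp
  ultimately show False by arith
qed

theorem support_eq:
  "support = {\<alpha> \<in> character_space. \<forall>a. ereal \<bar>\<alpha> a\<bar> \<le> moment_growth L a}"
  using support_subset subset_support support by blast

lemma compact_measurable: "compact D \<Longrightarrow> D \<subseteq> character_space \<Longrightarrow> D \<in> sets \<nu>"
  by (auto simp: sets_iff compact_imp_closed)

end

text \<open>By inner regularity of \<nu>2 a compact D' nearly fills the complement of D. An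
  evaluation close to a Urysohn function that is 1 on D and 0 on D' has integral L a under both
  measures. Up to small errors, L a is at least the \<nu>1-measure of D and at most the
  \<nu>2-measure of the complement of D'.\<close>

lemma compact_representation_le:
  assumes "compact_representation L \<nu>1" "compact_representation L \<nu>2"
    and D: "compact D" "D \<subseteq> character_space"
  shows "measure \<nu>1 D \<le> measure \<nu>2 D"
proof (rule field_le_epsilon)
  fix e :: real
  assume "0 < e"
  \<comment> \<open>One third for inner regularity, one for the approximation under each
    measure.\<close>
  then obtain d where e: "0 < d" "e = 3 * d"
    using that[of "e / 3"] by simp
  interpret r1: compact_representation L \<nu>1 by fact
  interpret r2: compact_representation L \<nu>2 by fact
  let ?X = "character_space :: ('a \<Rightarrow> real) set"
  have XD: "?X - D \<in> sets \<nu>2"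
    using r2.compact_measurable[OF D] r2.space_eq sets.compl_sets by metis
  then have "emeasure \<nu>2 (?X - D) =
      (SUP K\<in>{K. compactin character_topology K \<and> K \<subseteq> ?X - D}. emeasure \<nu>2 K)"
    using r2.radon by (simp add: radon_measure_def)
  then have "\<exists>D'\<in>{K. compactin character_topology K \<and> K \<subseteq> ?X - D}.
      emeasure \<nu>2 (?X - D) < emeasure \<nu>2 D' + ennreal (d)"
  proof (rule SUP_approx_ennreal[rotated 2])
    show "{K. compactin character_topology K \<and> K \<subseteq> ?X - D} \<noteq> {}"
      using compactin_empty by blast
  qed (use e(1) in \<open>auto simp: ennreal_less_zero_iff\<close>)
  then obtain D' where D': "compact D'" "D' \<subseteq> ?X - D"
      "emeasure \<nu>2 (?X - D) < emeasure \<nu>2 D' + ennreal (d)"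
    by (auto simp: compactin_character_topology)
  have D'X: "D' \<subseteq> ?X" using D' by auto
  have "measure \<nu>2 (?X - D) < measure \<nu>2 D' + d"
    using D'(3) e(1) by (simp add: r2.emeasure_eq_measure ennreal_less_iff flip: ennreal_plus)
  then have m2: "measure \<nu>2 (?X - D') \<le> measure \<nu>2 D + d"
    using r2.finite_measure_compl[OF r2.compact_measurable[OF D]]
      r2.finite_measure_compl[OF r2.compact_measurable[OF D'(1) D'X]]
    by (simp add: r2.space_eq)
  \<comment> \<open>Both supports are included so that the approximation holds almost everywhere for
    both measures.\<close>
  define Z where "Z = r1.support \<union> r2.support \<union> D \<union> D'"
  have Z: "compact Z" "Z \<subseteq> ?X"
    using r1.support r2.support D D'(1) D'X by (auto simp: Z_def)
  obtain h :: "('a \<Rightarrow> real) \<Rightarrow> real" where h: "continuous_on Z h"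
      "\<And>x. x \<in> Z \<Longrightarrow> 0 \<le> h x \<and> h x \<le> 1" "\<And>x. x \<in> D' \<Longrightarrow> h x = 0" "\<And>x. x \<in> D \<Longrightarrow> h x = 1"
    by (rule compact_Urysohn[OF Z(1) D'(1) D(1)]) (use D'(2) in \<open>auto simp: Z_def\<close>)
  obtain a where a: "\<And>\<beta>. \<beta> \<in> Z \<Longrightarrow> \<bar>h \<beta> - \<beta> a\<bar> < d"
    using character_approximation[OF Z h(1) e(1)] by blast
  have "measure \<nu>1 D = (\<integral>\<beta>. indicator D \<beta> \<partial>\<nu>1)"
    using D by (simp add: r1.space_eq Int_absorb2)
  also have "\<dots> \<le> (\<integral>\<beta>. \<beta> a + d \<partial>\<nu>1)"
  proof (rule integral_mono_AE)
    show "integrable \<nu>1 (indicator D :: _ \<Rightarrow> real)"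
      using r1.compact_measurable[OF D] by (simp add: r1.emeasure_eq_measure)
    show "AE \<beta> in \<nu>1. indicator D \<beta> \<le> \<beta> a + d"
      using r1.AE_support
    proof eventually_elim
      case (elim \<beta>)
      then have "\<beta> \<in> Z" by (simp add: Z_def)
      then show ?case using a[of \<beta>] h(2)[of \<beta>] h(4)[of \<beta>] by (auto simp: indicator_def)
    qed
  qed (simp add: r1.integrable_eval)
  also have "\<dots> = L a + d"
    using r1.integrable_eval by (simp add: r1.integral_eval r1.measure_space_one)
  also have "L a = (\<integral>\<beta>. \<beta> a \<partial>\<nu>2)"
    by (simp add: r2.integral_eval)
  also have "\<dots> \<le> (\<integral>\<beta>. indicator (?X - D') \<beta> + d \<partial>\<nu>2)"
  proof (rule integral_mono_AE)
    have "?X - D' \<in> sets \<nu>2"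
      using r2.compact_measurable[OF D'(1) D'X] r2.space_eq sets.compl_sets by metis
    then show "integrable \<nu>2 (\<lambda>\<beta>. indicator (?X - D') \<beta> + d)"
      by (simp add: r2.emeasure_eq_measure)
    show "AE \<beta> in \<nu>2. \<beta> a \<le> indicator (?X - D') \<beta> + d"
      using r2.AE_support
    proof eventually_elim
      case (elim \<beta>)
      then have "\<beta> \<in> Z" by (simp add: Z_def)
      then show ?case
        using a[of \<beta>] h(2)[of \<beta>] h(3)[of \<beta>] Z(2) by (auto simp: indicator_def)
    qed
  qed (simp add: r2.integrable_eval)
  also have "\<dots> = measure \<nu>2 (?X - D') + d"
  proof -
    have "?X - D' \<in> sets \<nu>2"
      using r2.compact_measurable[OF D'(1) D'X] r2.space_eq sets.compl_sets by metis
    moreover have "(?X - D') \<inter> ?X = ?X - D'" by blast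
    ultimately show ?thesis
      by (simp add: r2.emeasure_eq_measure r2.measure_space_one r2.space_eq[symmetric])
  qed
  finally show "measure \<nu>1 D \<le> measure \<nu>2 D + e"
    using m2 e(2) by simp
qed

theorem compact_representation_unique:
  assumes "compact_representation L \<nu>1" "compact_representation L \<nu>2"
  shows "\<nu>1 = \<nu>2"
proof (rule measure_eqI)
  interpret r1: compact_representation L \<nu>1 by fact
  interpret r2: compact_representation L \<nu>2 by fact
  show sets: "sets \<nu>1 = sets \<nu>2"
    by (simp add: r1.sets_eq r2.sets_eq)
  have compact_eq: "emeasure \<nu>1 D = emeasure \<nu>2 D" if "compactin character_topology D" for D
    using that compact_representation_le[OF assms, of D]
      compact_representation_le[OF assms(2,1), of D]
    by (simp add: compactin_character_topology r1.emeasure_eq_measure r2.emeasure_eq_measure)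
  fix B
  assume "B \<in> sets \<nu>1"
  then have "emeasure \<nu>1 B = (SUP K\<in>{K. compactin character_topology K \<and> K \<subseteq> B}. emeasure \<nu>1 K)"
    "emeasure \<nu>2 B = (SUP K\<in>{K. compactin character_topology K \<and> K \<subseteq> B}. emeasure \<nu>2 K)"
    using r1.radon r2.radon sets by (simp_all add: radon_measure_def)
  then show "emeasure \<nu>1 B = emeasure \<nu>2 B"
    using compact_eq by simp
qed

section \<open>Existence of the representing measure\<close>

lemma zero_if_small:
  fixes x C :: real
  assumes "0 \<le> C" "\<And>e. 0 < e \<Longrightarrow> \<bar>x\<bar> \<le> C * e"
  shows "x = 0"
proof (rule ccontr)
  assume "x \<noteq> 0"
  have "\<bar>x\<bar> \<le> C * (\<bar>x\<bar> / (2 * C + 1))"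
    using \<open>x \<noteq> 0\<close> assms(1) by (intro assms(2)) simp
  then have "\<bar>x\<bar> * (2 * C + 1) \<le> C * \<bar>x\<bar>"
    using assms(1) by (simp add: pos_le_divide_eq)
  then have "\<bar>x\<bar> * (C + 1) \<le> 0"
    by (simp add: algebra_simps)
  then show False
    using \<open>x \<noteq> 0\<close> assms(1) by (auto simp: mult_le_0_iff)
qed

locale bounded_state = growth_bound p for p :: "'a::{real_algebra_1, comm_ring_1} \<Rightarrow> real" +
  fixes L :: "'a \<Rightarrow> real"
  assumes state: "L \<in> states"
begin

lemma linear_L: "linear L" and L_one: "L 1 = 1"
  using state by (auto simp: states_def square_positive_def)

text \<open>Some bounded character is at most L at b - a. Consequently L a depends only on the
  values of the bounded characters at a.\<close>

lemma L_mono: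
  assumes "\<And>\<alpha>. \<alpha> \<in> bounded_characters \<Longrightarrow> \<alpha> a \<le> \<alpha> b"
  shows "L a \<le> L b"
proof -
  obtain \<alpha> where \<alpha>: "\<alpha> \<in> bounded_characters" "\<alpha> (b - a) \<le> L (b - a)"
    using state_ge_bounded_character[OF state] by blast
  then have "\<alpha> (b - a) = \<alpha> b - \<alpha> a"
    by (auto simp: bounded_characters_def character_space_def linear_diff)
  then show ?thesis
    using \<alpha> assms[OF \<alpha>(1)] by (simp add: linear_diff[OF linear_L])
qed

lemma bounded_character_eval_add_const:
  "\<alpha> \<in> bounded_characters \<Longrightarrow> \<alpha> (a + c *\<^sub>R 1) = \<alpha> a + c"
  by (auto simp: bounded_characters_def character_scaleR_one)
    (auto simp: character_space_def linear_add linear_scale)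

lemma L_add_const: "L (a + c *\<^sub>R 1) = L a + c"
  by (simp add: linear_add[OF linear_L] linear_scale[OF linear_L] L_one)

text \<open>
  Every continuous function is a uniform limit of evaluations, so this infimum is the unique
  positive extension of \<open>L\<close> to continuous functions.
\<close>

definition extension :: "(('a \<Rightarrow> real) \<Rightarrow> real) \<Rightarrow> real" where
  "extension f = Inf {L a | a. \<forall>\<alpha>\<in>bounded_characters. f \<alpha> \<le> \<alpha> a}"

text \<open>Shifting a by e and by -e encloses f between two evaluations. L of the upper one lies in
  the set, and by \<open>L_mono\<close> L of the lower one bounds it from below.\<close>

lemma extension_approx:
  assumes "\<And>\<alpha>. \<alpha> \<in> bounded_characters \<Longrightarrow> \<bar>f \<alpha> - \<alpha> a\<bar> \<le> e"
  shows "\<bar>extension f - L a\<bar> \<le> e"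
proof -
  let ?S = "{L b | b. \<forall>\<alpha>\<in>bounded_characters. f \<alpha> \<le> \<alpha> b}"
  have upper: "L (a + e *\<^sub>R 1) \<in> ?S"
    using assms by (force simp: bounded_character_eval_add_const abs_le_iff)
  have lower: "L a - e \<le> y" if y: "y \<in> ?S" for y
  proof -
    obtain b where b: "y = L b" "\<forall>\<alpha>\<in>bounded_characters. f \<alpha> \<le> \<alpha> b"
      using y by blast
    have "L (a + (- e) *\<^sub>R 1) \<le> L b"
    proof (rule L_mono)
      fix \<alpha>
      assume \<alpha>: "\<alpha> \<in> bounded_characters"
      then show "\<alpha> (a + (- e) *\<^sub>R 1) \<le> \<alpha> b"
        unfolding bounded_character_eval_add_const[OF \<alpha>] using assms[OF \<alpha>] b(2) by fastforce
    qed
    then show ?thesis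
      unfolding L_add_const b(1) by simp
  qed
  have "extension f \<le> L a + e"
    unfolding extension_def L_add_const[symmetric]
    by (rule cInf_lower[OF upper]) (rule bdd_belowI, rule lower)
  moreover have "L a - e \<le> extension f"
    unfolding extension_def by (rule cInf_greatest) (use upper lower in blast)+
  ultimately show ?thesis by (simp add: abs_le_iff)
qed

lemma extension_eval: "extension (\<lambda>\<alpha>. \<alpha> a) = L a"
  using extension_approx[of "\<lambda>\<alpha>. \<alpha> a" a 0] by simp

lemma ex_approx:
  assumes "continuous_on bounded_characters f" "0 < e"
  obtains a where "\<And>\<alpha>. \<alpha> \<in> bounded_characters \<Longrightarrow> \<bar>f \<alpha> - \<alpha> a\<bar> \<le> e" "\<bar>extension f - L a\<bar> \<le> e"
proof -
  obtain a where a: "\<And>\<alpha>. \<alpha> \<in> bounded_characters \<Longrightarrow> \<bar>f \<alpha> - \<alpha> a\<bar> < e"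
    using character_approximation[OF compact_bounded_characters _ assms]
    by (auto simp: bounded_characters_def)
  then have "\<And>\<alpha>. \<alpha> \<in> bounded_characters \<Longrightarrow> \<bar>f \<alpha> - \<alpha> a\<bar> \<le> e"
    by (simp add: less_imp_le)
  then show thesis
    using extension_approx that by blast
qed

text \<open>Sums and multiples are checked on approximating evaluations, where L is linear, with an
  error that is a fixed multiple of e. Positivity uses \<open>L_mono\<close> in the same
  way.\<close>

sublocale positive_functional_on extension bounded_characters
proof
  show "compact bounded_characters"
    by (rule compact_bounded_characters)
  have lin: "\<alpha> (a + b) = \<alpha> a + \<alpha> b" "\<alpha> (c *\<^sub>R a) = c * \<alpha> a"
    if "\<alpha> \<in> bounded_characters" for \<alpha> a b c
    using that by (auto simp: bounded_characters_def character_space_def linear_add linear_scale)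
  fix f :: "('a \<Rightarrow> real) \<Rightarrow> real"
  assume f: "continuous_on bounded_characters f"
  show "extension (\<lambda>\<alpha>. f \<alpha> + g \<alpha>) = extension f + extension g"
    if g: "continuous_on bounded_characters g" for g
  proof -
    have "extension (\<lambda>\<alpha>. f \<alpha> + g \<alpha>) - (extension f + extension g) = 0"
    proof (rule zero_if_small)
      fix e :: real
      assume e: "0 < e"
      obtain a where a: "\<And>\<alpha>. \<alpha> \<in> bounded_characters \<Longrightarrow> \<bar>f \<alpha> - \<alpha> a\<bar> \<le> e" "\<bar>extension f - L a\<bar> \<le> e"
        using ex_approx[OF f e] by blast
      obtain b where b: "\<And>\<alpha>. \<alpha> \<in> bounded_characters \<Longrightarrow> \<bar>g \<alpha> - \<alpha> b\<bar> \<le> e" "\<bar>extension g - L b\<bar> \<le> e"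
        using ex_approx[OF g e] by blast
      have "\<bar>extension (\<lambda>\<alpha>. f \<alpha> + g \<alpha>) - L (a + b)\<bar> \<le> 2 * e"
      proof (rule extension_approx)
        show "\<bar>f \<alpha> + g \<alpha> - \<alpha> (a + b)\<bar> \<le> 2 * e" if "\<alpha> \<in> bounded_characters" for \<alpha>
          using a(1)[OF that] b(1)[OF that] lin[OF that] by simp
      qed
      then show "\<bar>extension (\<lambda>\<alpha>. f \<alpha> + g \<alpha>) - (extension f + extension g)\<bar> \<le> 4 * e"
        using a(2) b(2) by (simp add: linear_add[OF linear_L])
    qed simp
    then show ?thesis by simp
  qed
  show "extension (\<lambda>\<alpha>. c * f \<alpha>) = c * extension f" for c
  proof -
    have "extension (\<lambda>\<alpha>. c * f \<alpha>) - c * extension f = 0"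
    proof (rule zero_if_small)
      fix e :: real
      assume e: "0 < e"
      obtain a where a: "\<And>\<alpha>. \<alpha> \<in> bounded_characters \<Longrightarrow> \<bar>f \<alpha> - \<alpha> a\<bar> \<le> e" "\<bar>extension f - L a\<bar> \<le> e"
        using ex_approx[OF f e] by blast
      have scaled: "\<bar>c * x - c * y\<bar> \<le> \<bar>c\<bar> * e" if "\<bar>x - y\<bar> \<le> e" for x y
        using mult_left_mono[OF that, of "\<bar>c\<bar>"] by (simp add: abs_mult[symmetric] right_diff_distrib)
      have "\<bar>extension (\<lambda>\<alpha>. c * f \<alpha>) - L (c *\<^sub>R a)\<bar> \<le> \<bar>c\<bar> * e"
      proof (rule extension_approx)
        show "\<bar>c * f \<alpha> - \<alpha> (c *\<^sub>R a)\<bar> \<le> \<bar>c\<bar> * e" if "\<alpha> \<in> bounded_characters" for \<alpha>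
          using scaled[OF a(1)[OF that]] lin[OF that] by simp
      qed
      then show "\<bar>extension (\<lambda>\<alpha>. c * f \<alpha>) - c * extension f\<bar> \<le> (2 * \<bar>c\<bar>) * e"
        using scaled[OF a(2)] by (simp add: linear_scale[OF linear_L])
    qed simp
    then show ?thesis by simp
  qed
  show "0 \<le> extension f" if pos: "\<And>\<alpha>. \<alpha> \<in> bounded_characters \<Longrightarrow> 0 \<le> f \<alpha>"
  proof (rule field_le_epsilon)
    fix e :: real
    assume "0 < e"
    then obtain d where e: "0 < d" "e = 2 * d"
      using that[of "e / 2"] by simp
    obtain a where a: "\<And>\<alpha>. \<alpha> \<in> bounded_characters \<Longrightarrow> \<bar>f \<alpha> - \<alpha> a\<bar> \<le> d"
        "\<bar>extension f - L a\<bar> \<le> d"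
      using ex_approx[OF f e(1)] by blast
    have "L 0 \<le> L (a + (d) *\<^sub>R 1)"
    proof (rule L_mono)
      fix \<alpha>
      assume \<alpha>: "\<alpha> \<in> bounded_characters"
      then show "\<alpha> 0 \<le> \<alpha> (a + (d) *\<^sub>R 1)"
        unfolding bounded_character_eval_add_const[OF \<alpha>]
        using a(1)[OF \<alpha>] pos[OF \<alpha>] lin(2)[OF \<alpha>, of 0 0] by simp
    qed
    then have "0 \<le> L a + d"
      unfolding L_add_const by (simp add: linear_0[OF linear_L])
    then show "0 \<le> extension f + e"
      using a(2) e(2) by simp
  qed
qed

text \<open>The Riesz measure lives on all functions from the algebra to the reals. Restriction to
  the characters gives the required underlying space and loses no mass, as the bounded characters
  carry all of it.\<close>

definition representing_measure :: "('a \<Rightarrow> real) measure" where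
  "representing_measure = restrict_space riesz_measure character_space"

lemma bounded_subset: "bounded_characters \<subseteq> character_space"
  by (auto simp: bounded_characters_def)

lemma character_space_measurable: "character_space \<inter> space riesz_measure \<in> sets riesz_measure"
  by simp

lemma space_representing_measure: "space representing_measure = character_space"
  by (simp add: representing_measure_def space_restrict_space)

lemma sets_representing_measure:
  "sets representing_measure = sets (restrict_space borel character_space)"
  unfolding representing_measure_def by (rule sets_restrict_space_cong) simp

lemma emeasure_representing_measure:
  "B \<subseteq> character_space \<Longrightarrow> emeasure representing_measure B = emeasure riesz_measure B"
  unfolding representing_measure_def
  using character_space_measurable by (rule emeasure_restrict_space)

text \<open>The total mass is finite, which gives local finiteness. Inner regularity is inherited
  because a set of characters has the same compact subsets in both topologies.\<close>

lemma radon_representing_measure: "radon_measure character_topology representing_measure"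
  unfolding radon_measure_def
proof (intro conjI ballI)
  show "space representing_measure = topspace character_topology"
    by (simp add: space_representing_measure)
  show "sets representing_measure =
      sigma_sets (topspace character_topology) {U. openin character_topology U}"
    by (simp add: sets_representing_measure sets_character_topology[symmetric])
  show "\<exists>U. openin character_topology U \<and> x \<in> U \<and> emeasure representing_measure U < \<infinity>"
    if "x \<in> topspace character_topology" for x
  proof (intro exI conjI)
    show "openin character_topology (topspace character_topology)"
      by (rule openin_topspace)
    show "emeasure representing_measure (topspace character_topology) < \<infinity>"
      using riesz.emeasure_finite[of character_space]
      by (simp add: emeasure_representing_measure less_top[symmetric])
  qed (rule that)
  fix B
  assume "B \<in> sets representing_measure"
  then have B: "B \<in> sets borel" "B \<subseteq> character_space"
    by (auto simp: sets_representing_measure sets_restrict_space_iff)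
  have "{K. compactin character_topology K \<and> K \<subseteq> B} = {C. compact C \<and> C \<subseteq> B}"
    using B(2) by (auto simp: compactin_character_topology)
  moreover have "(SUP C\<in>{C. compact C \<and> C \<subseteq> B}. emeasure representing_measure C) =
      (SUP C\<in>{C. compact C \<and> C \<subseteq> B}. emeasure riesz_measure C)"
    using B(2) by (intro SUP_cong) (auto simp: emeasure_representing_measure)
  ultimately show "emeasure representing_measure B =
      (SUP K\<in>{K. compactin character_topology K \<and> K \<subseteq> B}. emeasure representing_measure K)"
    using inner_regular[OF B(1)] B(2) by (simp add: emeasure_representing_measure)
qed

lemma representing_representing_measure: "representing_radon_measure L representing_measure"
  unfolding representing_radon_measure_def
proof (intro conjI allI radon_representing_measure)
  fix a
  have eval: "continuous_on UNIV (\<lambda>\<alpha> :: 'a \<Rightarrow> real. \<alpha> a)"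
    by (rule continuous_on_coordinate)
  note int = integrable_riesz_measure[OF eval]
  have "integrable riesz_measure (\<lambda>\<alpha>. indicator character_space \<alpha> *\<^sub>R \<alpha> a)"
    using character_space_measurable int by (intro integrable_mult_indicator) auto
  then show "integrable representing_measure (\<lambda>\<alpha>. \<alpha> a)"
    unfolding representing_measure_def
    by (simp only: integrable_restrict_space[OF character_space_measurable])
  have "(\<integral>\<alpha>. \<alpha> a \<partial>representing_measure) =
      (\<integral>\<alpha>. indicator character_space \<alpha> *\<^sub>R \<alpha> a \<partial>riesz_measure)"
    unfolding representing_measure_def
    by (rule integral_restrict_space[OF character_space_measurable])
  also have "\<dots> = (\<integral>\<alpha>. \<alpha> a \<partial>riesz_measure)"
  proof (rule integral_cong_AE)
    show "(\<lambda>\<alpha>. indicator character_space \<alpha> *\<^sub>R \<alpha> a) \<in> borel_measurable riesz_measure"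
      using \<open>integrable riesz_measure (\<lambda>\<alpha>. indicator character_space \<alpha> *\<^sub>R \<alpha> a)\<close> by auto
    show "(\<lambda>\<alpha>. \<alpha> a) \<in> borel_measurable riesz_measure"
      using int by auto
    show "AE \<alpha> in riesz_measure. indicator character_space \<alpha> *\<^sub>R \<alpha> a = \<alpha> a"
      using AE_in_K bounded_subset by (auto elim!: eventually_mono)
  qed
  also have "\<dots> = L a"
    by (simp add: integral_riesz_measure[OF eval] extension_eval)
  finally show "L a = (\<integral>\<alpha>. \<alpha> a \<partial>representing_measure)" ..
qed

lemma compactly_supported_representing_measure:
  "compactly_supported character_topology representing_measure"
proof -
  have "emeasure representing_measure (character_space - bounded_characters) \<le>
      emeasure riesz_measure (- bounded_characters)"
    using closed_K by (subst emeasure_representing_measure) (auto intro!: emeasure_mono)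
  then have "emeasure representing_measure (topspace character_topology - bounded_characters) = 0"
    by (simp add: emeasure_outside_K)
  then have sub: "measure_support character_topology representing_measure \<subseteq> bounded_characters"
    using closed_K bounded_subset
    by (intro measure_support_radon(3)[OF radon_representing_measure])
      (auto simp: closedin_character_topology)
  have "compactin character_topology bounded_characters"
    by (simp add: compactin_character_topology compact_bounded_characters bounded_subset)
  then show ?thesis
    unfolding compactly_supported_def
    using sub measure_support_radon(1)[OF radon_representing_measure]
    by (rule closed_compactin)
qed

end

section \<open>From finite moment growth to a bounded state\<close>

lemma moment_growth_nonneg:
  assumes "\<And>a. 0 \<le> L (a\<^sup>2)"
  shows "0 \<le> moment_growth L a"
  unfolding moment_growth_def using assms[of a]
  by (intro SUP_upper2[of 1]) auto

text \<open>Finite growth, read as a real function p, satisfies \<open>growth_bound\<close>, because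
  the moments of a^n are moments of a of n times the order. Cauchy-Schwarz against 1 gives |L c| <=
  p c, so L is a state.\<close>

theorem compact_representation_exists:
  fixes L :: "'a::{real_algebra_1, comm_ring_1} \<Rightarrow> real"
  assumes lin: "linear L" and pos: "\<And>a. L (a\<^sup>2) \<ge> 0" and one: "L 1 = 1"
    and growth: "\<And>a. moment_growth L a < \<infinity>"
  obtains \<nu> where "representing_radon_measure L \<nu>" "compactly_supported character_topology \<nu>"
proof -
  define p where "p a = real_of_ereal (moment_growth L a)" for a
  have p: "moment_growth L a = ereal (p a)" "0 \<le> p a" for a
    using growth[of a] moment_growth_nonneg[where L = L and a = a, OF pos]
    by (cases "moment_growth L a"; simp add: p_def)+
  have even_pos: "0 \<le> L (a ^ (2 * n))" for a n
    using pos[of "a ^ n"] by (simp add: power_mult[symmetric] mult.commute)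
  \<comment> \<open>The case n = 0 lies outside the supremum and comes from L 1 = 1; it serves the
    power a^0 in \<open>p_power\<close>.\<close>
  have moment: "L (a ^ (2 * n)) \<le> p a ^ (2 * n)" for a n
    using moment_le_power[of L a "p a" n] p even_pos one by (cases "n = 0") auto
  interpret growth_bound p
  proof
    show "0 \<le> p a" for a by (rule p)
    show "p (a ^ n) \<le> p a ^ n" for a n
    proof -
      have "moment_growth L (a ^ n) \<le> ereal (p a ^ n)"
      proof (rule moment_growth_le)
        show "0 \<le> p a ^ n" using p by simp
        show "L ((a ^ n) ^ (2 * m)) \<le> (p a ^ n) ^ (2 * m)" for m
          using moment[of a "n * m"] by (simp add: power_mult[symmetric] mult.left_commute)
      qed
      then show ?thesis by (simp add: p)
    qed
  qed
  have sp: "square_positive L"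
    using lin pos by (simp add: square_positive_def)
  have "\<bar>L c\<bar> \<le> p c" for c
  proof -
    have "(L c)\<^sup>2 \<le> (p c)\<^sup>2"
      using square_positive_Cauchy_Schwarz[OF sp, of 1 c] moment[of c 1] one by simp
    then show ?thesis
      using p(2)[of c] by (simp add: abs_le_square_iff[symmetric])
  qed
  then interpret bounded_state p L
    by unfold_locales (use sp one in \<open>simp add: states_def\<close>)
  show thesis
    using that representing_representing_measure compactly_supported_representing_measure .
qed

theorem theorem1p2:
  fixes L :: "'a::{real_algebra_1, comm_ring_1} \<Rightarrow> real"
  assumes "(character_space :: ('a \<Rightarrow> real) set) \<noteq> {}"
    and "linear L"
    and "\<And>a. L (a\<^sup>2) \<ge> 0"
    and "L 1 = 1"
  shows "((\<exists>!\<nu>. representing_radon_measure L \<nu> \<and> compactly_supported character_topology \<nu>)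
            \<longleftrightarrow> (\<forall>a. moment_growth L a < \<infinity>)) \<and>
         ((\<forall>a. moment_growth L a < \<infinity>) \<longrightarrow>
            (\<forall>\<nu>. representing_radon_measure L \<nu> \<and> compactly_supported character_topology \<nu> \<longrightarrow>
               measure_support character_topology \<nu> =
                 {\<alpha> \<in> character_space. \<forall>a. ereal \<bar>\<alpha> a\<bar> \<le> moment_growth L a}))"
proof -
  have rep: "compact_representation L \<nu>"
    if "representing_radon_measure L \<nu>" "compactly_supported character_topology \<nu>" for \<nu>
    using that assms(4) by unfold_locales
  show ?thesis
  proof (intro conjI iffI impI allI)
    assume "\<forall>a. moment_growth L a < \<infinity>"
    then show "\<exists>!\<nu>. representing_radon_measure L \<nu> \<and> compactly_supported character_topology \<nu>"
      using compact_representation_exists[OF assms(2-4)] compact_representation_unique rep by metis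
  next
    fix a
    assume "\<exists>!\<nu>. representing_radon_measure L \<nu> \<and> compactly_supported character_topology \<nu>"
    then show "moment_growth L a < \<infinity>"
      using rep compact_representation.moment_growth_finite by blast
  next
    fix \<nu>
    assume "representing_radon_measure L \<nu> \<and> compactly_supported character_topology \<nu>"
    then show "measure_support character_topology \<nu> =
        {\<alpha> \<in> character_space. \<forall>a. ereal \<bar>\<alpha> a\<bar> \<le> moment_growth L a}"
      using rep compact_representation.support_eq by blast
  qed
qed

end
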